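(* Let $C$ be a convex $n$-gon, $n\ge 5$. In the $(1:1)$ triangulation Maker-Breaker game on $C$, Maker has a winning strategy within $n-3$ moves. On the other hand, in the $(1:2)$ triangulation Maker-Breaker game on $C$, Breaker has a winning strategy within $n-3$ moves. In particular, the threshold bias of the game is $2$.
   Context: A diagonal of $C$ is a segment joining two non-adjacent vertices of $C$; two distinct diagonals cross if they share an interior point; a triangulation of $C$ is a maximal (with respect to inclusion) set of pairwise non-crossing diagonals of $C$ (it has $n-3$ elements). In the $(m:b)$ Maker-Breaker game on a finite board $X$ with a family $\mathcal{F}$ of subsets of $X$ (the winning sets), two players, Maker and Breaker, alternately claim previously unclaimed elements of $X$. Maker goes first and claims $m$ elements in each of her turns; Breaker claims $b$ elements in each of his turns (if fewer unclaimed elements remain, the player claims all remaining ones). Maker wins if the set of elements she claimed contains a winning set; otherwise Breaker wins. A player's "move" here means a turn of that player. Maker wins within $t$ moves if after at most $t$ of her turns her claimed set contains a winning set; Breaker wins within $t$ moves if after at most $t$ of his turns his claimed set meets every winning set (so that Maker cannot win). The threshold bias is the minimal positive integer $b$ such that Breaker has a winning strategy in the $(1:b)$ game. The triangulation Maker-Breaker game on $C$ is the game in which the board $X$ is the set of diagonals of $C$ and the winning sets are the triangulations of $C$. *)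

theory Defs
  imports "HOL-Analysis.Analysis"
begin

subsection \<open>Convex polygons, diagonals, triangulations\<close>

text \<open>
  The vertices of a polygon are its extreme points and its sides are its one-dimensional faces, so
  all angles at vertices are strictly smaller than a straight angle.
\<close>

definition vertices :: "(real^2) set \<Rightarrow> (real^2) set" where
  "vertices C = {v. v extreme_point_of C}"

definition convex_ngon :: "nat \<Rightarrow> (real^2) set \<Rightarrow> bool" where
  "convex_ngon n C \<longleftrightarrow> polytope C \<and> aff_dim C = 2 \<and> card (vertices C) = n"

definition adjacent_vertices :: "(real^2) set \<Rightarrow> real^2 \<Rightarrow> real^2 \<Rightarrow> bool" where
  "adjacent_vertices C u v \<longleftrightarrow>
     u \<in> vertices C \<and> v \<in> vertices C \<and> u \<noteq> v \<and> closed_segment u v edge_of C"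

definition diagonals :: "(real^2) set \<Rightarrow> (real^2) set set" where
  "diagonals C = {closed_segment u v | u v.
     u \<in> vertices C \<and> v \<in> vertices C \<and> u \<noteq> v \<and> \<not> adjacent_vertices C u v}"

text \<open>The interior of a segment is its relative interior, the segment without its endpoints.\<close>

definition crossing :: "(real^2) set \<Rightarrow> (real^2) set \<Rightarrow> bool" where
  "crossing d e \<longleftrightarrow> d \<noteq> e \<and> rel_interior d \<inter> rel_interior e \<noteq> {}"

definition noncrossing_family :: "(real^2) set \<Rightarrow> (real^2) set set \<Rightarrow> bool" where
  "noncrossing_family C D \<longleftrightarrow> D \<subseteq> diagonals C \<and> pairwise (\<lambda>d e. \<not> crossing d e) D"

definition triangulations :: "(real^2) set \<Rightarrow> (real^2) set set set" where
  "triangulations C =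
     {D. noncrossing_family C D \<and> (\<forall>E. noncrossing_family C E \<and> D \<subseteq> E \<longrightarrow> E = D)}"


subsection \<open>Biased Maker-Breaker games on a finite board\<close>

text \<open>
  The turns are numbered 0, 1, 2, ..., the even ones being Maker's and the odd ones Breaker's; a turn
  is the set of elements claimed in it. A play is an infinite sequence of turns, all of which are
  empty once the board is exhausted. Play is not stopped when a player has won; this is
  harmless, as both winning conditions persist under claiming further elements.
\<close>

definition turn_bias :: "nat \<Rightarrow> nat \<Rightarrow> nat \<Rightarrow> nat" where
  "turn_bias m b k = (if even k then m else b)"

definition legal_turn :: "nat \<Rightarrow> 'a set \<Rightarrow> 'a set \<Rightarrow> bool" where
  "legal_turn q U S \<longleftrightarrow> S \<subseteq> U \<and> card S = min q (card U)"

definition legal_history :: "nat \<Rightarrow> nat \<Rightarrow> 'a set \<Rightarrow> 'a set list \<Rightarrow> bool" where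
  "legal_history m b X h \<longleftrightarrow>
     (\<forall>k<length h. legal_turn (turn_bias m b k) (X - \<Union>(set (take k h))) (h ! k))"

definition legal_play :: "nat \<Rightarrow> nat \<Rightarrow> 'a set \<Rightarrow> (nat \<Rightarrow> 'a set) \<Rightarrow> bool" where
  "legal_play m b X T \<longleftrightarrow>
     (\<forall>k. legal_turn (turn_bias m b k) (X - (\<Union>j<k. T j)) (T k))"

definition maker_claimed :: "(nat \<Rightarrow> 'a set) \<Rightarrow> nat \<Rightarrow> 'a set" where
  "maker_claimed T t = (\<Union>i<t. T (2 * i))"

definition breaker_claimed :: "(nat \<Rightarrow> 'a set) \<Rightarrow> nat \<Rightarrow> 'a set" where
  "breaker_claimed T t = (\<Union>i<t. T (2 * i + 1))"

text \<open>
  A strategy maps the history of all previous turns to the next turn. It has to prescribe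
  a legal turn after every legal history at which its owner is to move; without this requirement
  a strategy prescribing illegal turns would be followed by no play and so would win vacuously.
\<close>

type_synonym 'a strategy = "'a set list \<Rightarrow> 'a set"

definition maker_strategy :: "nat \<Rightarrow> nat \<Rightarrow> 'a set \<Rightarrow> 'a strategy \<Rightarrow> bool" where
  "maker_strategy m b X \<sigma> \<longleftrightarrow>
     (\<forall>h. legal_history m b X h \<and> even (length h) \<longrightarrow> legal_turn m (X - \<Union>(set h)) (\<sigma> h))"

definition breaker_strategy :: "nat \<Rightarrow> nat \<Rightarrow> 'a set \<Rightarrow> 'a strategy \<Rightarrow> bool" where
  "breaker_strategy m b X \<sigma> \<longleftrightarrow>
     (\<forall>h. legal_history m b X h \<and> odd (length h) \<longrightarrow> legal_turn b (X - \<Union>(set h)) (\<sigma> h))"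

definition maker_follows :: "'a strategy \<Rightarrow> (nat \<Rightarrow> 'a set) \<Rightarrow> bool" where
  "maker_follows \<sigma> T \<longleftrightarrow> (\<forall>k. even k \<longrightarrow> T k = \<sigma> (map T [0..<k]))"

definition breaker_follows :: "'a strategy \<Rightarrow> (nat \<Rightarrow> 'a set) \<Rightarrow> bool" where
  "breaker_follows \<sigma> T \<longleftrightarrow> (\<forall>k. odd k \<longrightarrow> T k = \<sigma> (map T [0..<k]))"

definition maker_wins_within :: "nat \<Rightarrow> nat \<Rightarrow> 'a set \<Rightarrow> 'a set set \<Rightarrow> nat \<Rightarrow> bool" where
  "maker_wins_within m b X \<F> t \<longleftrightarrow>
     (\<exists>\<sigma>. maker_strategy m b X \<sigma> \<and>
        (\<forall>T. legal_play m b X T \<and> maker_follows \<sigma> T \<longrightarrow>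
           (\<exists>s\<le>t. \<exists>F\<in>\<F>. F \<subseteq> maker_claimed T s)))"

definition breaker_wins_within :: "nat \<Rightarrow> nat \<Rightarrow> 'a set \<Rightarrow> 'a set set \<Rightarrow> nat \<Rightarrow> bool" where
  "breaker_wins_within m b X \<F> t \<longleftrightarrow>
     (\<exists>\<sigma>. breaker_strategy m b X \<sigma> \<and>
        (\<forall>T. legal_play m b X T \<and> breaker_follows \<sigma> T \<longrightarrow>
           (\<exists>s\<le>t. \<forall>F\<in>\<F>. F \<inter> breaker_claimed T s \<noteq> {})))"

text \<open>Without a bound on the number of moves, Breaker wins a play iff Maker never completes a winning set.\<close>

definition breaker_wins :: "nat \<Rightarrow> nat \<Rightarrow> 'a set \<Rightarrow> 'a set set \<Rightarrow> bool" where
  "breaker_wins m b X \<F> \<longleftrightarrow>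
     (\<exists>\<sigma>. breaker_strategy m b X \<sigma> \<and>
        (\<forall>T. legal_play m b X T \<and> breaker_follows \<sigma> T \<longrightarrow>
           \<not> (\<exists>t. \<exists>F\<in>\<F>. F \<subseteq> maker_claimed T t)))"

definition is_threshold_bias :: "'a set \<Rightarrow> 'a set set \<Rightarrow> nat \<Rightarrow> bool" where
  "is_threshold_bias X \<F> b \<longleftrightarrow>
     b > 0 \<and> breaker_wins 1 b X \<F> \<and> (\<forall>c. 0 < c \<and> c < b \<longrightarrow> \<not> breaker_wins 1 c X \<F>)"

end

theory Submission
  imports Defs
begin

text \<open>
  Maker keeps a convex polygon W spanned by the vertices not yet cut off, and in each turn claims the
  diagonal cutting off an ear of W. Breaker can claim only one diagonal of W per turn; cutting off
  the ear at one of its endpoints makes it irrelevant, so that after n - 3 turns Maker has completed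
  a triangulation.

  In the (1:2) game Breaker picks a side ab none of whose endpoints lies on Maker's first diagonal.
  Every triangulation has a triangle abc, whose other two edges are sides or diagonals of the
  triangulation. Breaker first claims the two diagonals that make the neighbours of a and b
  impossible as c. For each of the remaining n - 4 vertices c, both ac and bc are diagonals; he answers
  one of them with the other, and spoils at least one more c per turn.
\<close>


subsection \<open>Maker-Breaker games\<close>

text \<open>The geometry enters only through the cyclic order of the vertices: in convex position,
  being a side and crossing depend just on which vertices lie on which side of a chord, so ears and
  triangles can be handled combinatorially. The two bounds n - 3 have different origins. Maker
  shrinks W from n vertices to 3, one per turn. Breaker has to spoil n - 2 apexes, two of them in
  his first turn. Those two are urgent: the neighbours of a and b off the side ab form triangles
  with only one diagonal each, so one claim of Maker would put such an apex out of reach, and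
  Breaker needs both his claims at once. A first diagonal of Maker ending at a or b would take one
  of these diagonals or create a third urgent apex, hence the choice of ab after her first turn.
  Every other apex has two diagonals, each lying in just one triangle abc, so Maker threatens at
  most one apex per turn and one answering claim suffices.\<close>

lemma legal_turn_exists:
  assumes "finite U" shows "\<exists>S. legal_turn q U S"
  by (metis assms legal_turn_def min.cobounded2 obtain_subset_with_card_n)

lemma legal_turn_exists_superset:
  assumes "finite U" "A \<subseteq> U" "card A \<le> q"
  shows "\<exists>S. legal_turn q U S \<and> A \<subseteq> S"
proof -
  have "card A \<le> min q (card U)" using assms by (simp add: card_mono)
  then obtain S where "A \<subseteq> S" "S \<subseteq> U" "card S = min q (card U)"
    using exists_subset_between[of A "min q (card U)" U] assms by auto
  then show ?thesis by (auto simp: legal_turn_def)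
qed

text \<open>The flag is the parity of the turn: \<open>True\<close> selects Maker's turns and
  \<open>False\<close> Breaker's. This is the counterpart of \<open>maker_claimed\<close> and
  \<open>breaker_claimed\<close> for finite histories.\<close>

definition claims :: "bool \<Rightarrow> 'a set list \<Rightarrow> 'a set" where
  "claims p h = (\<Union>k\<in>{k. k < length h \<and> even k = p}. h ! k)"

lemma claims_Un: "claims True h \<union> claims False h = \<Union>(set h)"
  unfolding claims_def by (force simp: set_conv_nth)

lemma claims_play_even:
  "claims True (map T [0..<2 * t]) = maker_claimed T t"
  "claims False (map T [0..<2 * t]) = breaker_claimed T t"
proof -
  have e: "{k. k < 2 * t \<and> even k} = (\<lambda>i. 2 * i) ` {..<t}"
    by (auto elim!: evenE)
  have o: "{k. k < 2 * t \<and> odd k} = (\<lambda>i. 2 * i + 1) ` {..<t}"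
    by (auto elim!: oddE)
  have "claims True (map T [0..<2 * t]) = (\<Union>k\<in>{k. k < 2 * t \<and> even k}. T k)"
    unfolding claims_def by auto
  then show "claims True (map T [0..<2 * t]) = maker_claimed T t"
    unfolding e maker_claimed_def by simp
  have "claims False (map T [0..<2 * t]) = (\<Union>k\<in>{k. k < 2 * t \<and> odd k}. T k)"
    unfolding claims_def by auto
  then show "claims False (map T [0..<2 * t]) = breaker_claimed T t"
    unfolding o breaker_claimed_def by simp
qed

lemma claims_snoc:
  "claims p (h @ [S]) = (if even (length h) = p then claims p h \<union> S else claims p h)"
proof -
  have "{k. k < Suc (length h) \<and> even k = p} =
    (if even (length h) = p then insert (length h) {k. k < length h \<and> even k = p}
     else {k. k < length h \<and> even k = p})"
    by (auto simp: less_Suc_eq)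
  then show ?thesis by (auto simp: claims_def nth_append)
qed

lemma claims_play_odd:
  "claims True (map T [0..<2 * t + 1]) = maker_claimed T t \<union> T (2 * t)"
  "claims False (map T [0..<2 * t + 1]) = breaker_claimed T t"
  by (simp_all add: claims_snoc claims_play_even)

lemma maker_claimed_Suc: "maker_claimed T (Suc t) = maker_claimed T t \<union> T (2 * t)"
  by (auto simp: maker_claimed_def lessThan_Suc)

lemma breaker_claimed_Suc: "breaker_claimed T (Suc t) = breaker_claimed T t \<union> T (2 * t + 1)"
  by (auto simp: breaker_claimed_def lessThan_Suc)

lemma play_prefix_even: "(\<Union>j<2 * t. T j) = maker_claimed T t \<union> breaker_claimed T t"
  using claims_Un[of "map T [0..<2 * t]"] by (simp add: claims_play_even atLeast0LessThan)

lemma play_prefix_odd: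
  "(\<Union>j<2 * t + 1. T j) = maker_claimed T t \<union> breaker_claimed T t \<union> T (2 * t)"
  using play_prefix_even[of T t] by (auto simp: less_Suc_eq lessThan_Suc)

lemma legal_play_even:
  assumes "legal_play m b X T"
  shows "legal_turn m (X - (maker_claimed T t \<union> breaker_claimed T t)) (T (2 * t))"
  using assms[unfolded legal_play_def, rule_format, of "2 * t"]
  by (simp add: play_prefix_even turn_bias_def)

lemma legal_play_odd:
  assumes "legal_play m b X T"
  shows "legal_turn b (X - (maker_claimed T t \<union> breaker_claimed T t) - T (2 * t)) (T (2 * t + 1))"
  using assms[unfolded legal_play_def, rule_format, of "2 * t + 1"]
  unfolding play_prefix_odd by (simp add: turn_bias_def Diff_eq Int_assoc)

text \<open>\<open>I\<close> is an invariant of the position after \<open>t\<close> full rounds. It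
  sees only the claimed sets, while a strategy is a function of the history: \<open>claims\<close>
  recovers the sets, half the length the round, and choice picks a turn.\<close>

lemma maker_wins_withinI:
  assumes fin: "finite X" and init: "I 0 {} {}"
    and step: "\<And>t M B. t < N \<Longrightarrow> I t M B \<Longrightarrow>
      \<exists>S. legal_turn m (X - (M \<union> B)) S \<and>
        (\<forall>S'. legal_turn b (X - (M \<union> B) - S) S' \<longrightarrow> I (Suc t) (M \<union> S) (B \<union> S'))"
    and final: "\<And>M B. I N M B \<Longrightarrow> \<exists>F\<in>\<F>. F \<subseteq> M"
  shows "maker_wins_within m b X \<F> N"
proof -
  define good where "good h S \<longleftrightarrow> legal_turn m (X - (claims True h \<union> claims False h)) S \<and>
    (\<forall>S'. legal_turn b (X - (claims True h \<union> claims False h) - S) S' \<longrightarrow>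
       I (Suc (length h div 2)) (claims True h \<union> S) (claims False h \<union> S'))" for h S
  \<comment> \<open>The fallback is an arbitrary legal turn, since a strategy must be legal also at
    histories where the invariant has been lost.\<close>
  define \<sigma> where "\<sigma> h = (if \<exists>S. good h S then SOME S. good h S
    else SOME S. legal_turn m (X - \<Union>(set h)) S)" for h
  have good: "good h (\<sigma> h)" if "\<exists>S. good h S" for h
    using someI_ex[OF that] that by (simp add: \<sigma>_def)
  have "legal_turn m (X - \<Union>(set h)) (\<sigma> h)" for h
  proof (cases "\<exists>S. good h S")
    case True
    then show ?thesis using good[of h] by (simp add: good_def claims_Un)
  next
    case False
    have "\<exists>S. legal_turn m (X - \<Union>(set h)) S" using fin by (intro legal_turn_exists) auto
    from someI_ex[OF this] show ?thesis using False by (simp add: \<sigma>_def)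
  qed
  then have "maker_strategy m b X \<sigma>" by (simp add: maker_strategy_def)
  moreover have "\<exists>s\<le>N. \<exists>F\<in>\<F>. F \<subseteq> maker_claimed T s"
    if play: "legal_play m b X T" and follows: "maker_follows \<sigma> T" for T
  proof -
    have "I t (maker_claimed T t) (breaker_claimed T t)" if "t \<le> N" for t
      using that
    proof (induction t)
      case 0
      then show ?case using init by (simp add: maker_claimed_def breaker_claimed_def)
    next
      case (Suc t)
      let ?h = "map T [0..<2 * t]"
      have "\<exists>S. good ?h S"
        using step[of t] Suc by (simp add: good_def claims_play_even)
      then have "good ?h (T (2 * t))"
        using good follows by (simp add: maker_follows_def)
      then show ?case
        using legal_play_odd[OF play, of t]
        by (simp add: good_def claims_play_even maker_claimed_Suc breaker_claimed_Suc)
    qed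
    then show ?thesis using final by blast
  qed
  ultimately show ?thesis unfolding maker_wins_within_def by blast
qed

lemma breaker_wins_withinI:
  assumes fin: "finite X" and init: "I 0 {} {}"
    and step: "\<And>t M B S. t < N \<Longrightarrow> I t M B \<Longrightarrow> legal_turn m (X - (M \<union> B)) S \<Longrightarrow>
      \<exists>S'. legal_turn b (X - (M \<union> B) - S) S' \<and> I (Suc t) (M \<union> S) (B \<union> S')"
    and final: "\<And>M B. I N M B \<Longrightarrow> \<forall>F\<in>\<F>. F \<inter> B \<noteq> {}"
  shows "breaker_wins_within m b X \<F> N"
proof -
  \<comment> \<open>Breaker moves at histories of odd length 2t + 1, where
    \<open>claims True h\<close> already contains Maker's current turn; \<open>div\<close> rounds
    down to \<open>t\<close>.\<close>
  define good where "good h S' \<longleftrightarrow> legal_turn b (X - (claims True h \<union> claims False h)) S' \<and>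
       I (Suc (length h div 2)) (claims True h) (claims False h \<union> S')" for h S'
  define \<sigma> where "\<sigma> h = (if \<exists>S. good h S then SOME S. good h S
    else SOME S. legal_turn b (X - \<Union>(set h)) S)" for h
  have good: "good h (\<sigma> h)" if "\<exists>S. good h S" for h
    using someI_ex[OF that] that by (simp add: \<sigma>_def)
  have "legal_turn b (X - \<Union>(set h)) (\<sigma> h)" for h
  proof (cases "\<exists>S. good h S")
    case True
    then show ?thesis using good[of h] by (simp add: good_def claims_Un)
  next
    case False
    have "\<exists>S. legal_turn b (X - \<Union>(set h)) S" using fin by (intro legal_turn_exists) auto
    from someI_ex[OF this] show ?thesis using False by (simp add: \<sigma>_def)
  qed
  then have "breaker_strategy m b X \<sigma>" by (simp add: breaker_strategy_def)
  moreover have "\<exists>s\<le>N. \<forall>F\<in>\<F>. F \<inter> breaker_claimed T s \<noteq> {}"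
    if play: "legal_play m b X T" and follows: "breaker_follows \<sigma> T" for T
  proof -
    have "I t (maker_claimed T t) (breaker_claimed T t)" if "t \<le> N" for t
      using that
    proof (induction t)
      case 0
      then show ?case using init by (simp add: maker_claimed_def breaker_claimed_def)
    next
      case (Suc t)
      let ?h = "map T [0..<2 * t + 1]"
      have *: "X - (A \<union> D) - E = X - (A \<union> E \<union> D)" for A D E by blast
      have "\<exists>S. good ?h S"
        using step[of t, OF _ _ legal_play_even[OF play]] Suc
        unfolding good_def claims_play_odd * by simp
      then have "good ?h (T (2 * t + 1))"
        using good follows unfolding breaker_follows_def by simp
      then show ?case
        unfolding good_def claims_play_odd by (simp add: maker_claimed_Suc breaker_claimed_Suc)
    qed
    then show ?thesis using final by blast
  qed
  ultimately show ?thesis unfolding breaker_wins_within_def by blast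
qed

lemma legal_play_disjoint:
  assumes "legal_play m b X T" "i < j"
  shows "T i \<inter> T j = {}"
  using assms unfolding legal_play_def legal_turn_def by blast

text \<open>The claims of the two players are disjoint at all times, so a winning set hit by Breaker
  once can never be completed, before or after.\<close>

lemma breaker_wins_within_imp_breaker_wins:
  assumes "breaker_wins_within m b X \<F> t"
  shows "breaker_wins m b X \<F>"
proof -
  have disjoint: "maker_claimed T s \<inter> breaker_claimed T s' = {}" if "legal_play m b X T" for T s s'
  proof -
    have *: "T (2 * i) \<inter> T (2 * j + 1) = {}" for i j
    proof -
      have "2 * i < 2 * j + 1 \<or> 2 * j + 1 < 2 * i" by presburger
      then show ?thesis using legal_play_disjoint[OF that] by (metis Int_commute)
    qed
    then show ?thesis unfolding maker_claimed_def breaker_claimed_def Int_UN_distrib2 * by simp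
  qed
  from assms obtain \<sigma> where \<sigma>: "breaker_strategy m b X \<sigma>"
    and hit: "\<And>T. legal_play m b X T \<Longrightarrow> breaker_follows \<sigma> T \<Longrightarrow>
      \<exists>s\<le>t. \<forall>F\<in>\<F>. F \<inter> breaker_claimed T s \<noteq> {}"
    unfolding breaker_wins_within_def by auto
  have "\<not> F \<subseteq> maker_claimed T s"
    if play: "legal_play m b X T" "breaker_follows \<sigma> T" and F: "F \<in> \<F>" for T s F
  proof -
    obtain s' where "F \<inter> breaker_claimed T s' \<noteq> {}" using hit[OF play] F by meson
    then show ?thesis using disjoint[OF play(1), of s s'] by blast
  qed
  then show ?thesis using \<sigma> unfolding breaker_wins_def by auto
qed

section \<open>Two strategies played against each other\<close>

fun play_history :: "'a strategy \<Rightarrow> 'a strategy \<Rightarrow> nat \<Rightarrow> 'a set list" where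
  "play_history \<sigma> \<tau> 0 = []"
| "play_history \<sigma> \<tau> (Suc k) = play_history \<sigma> \<tau> k @
     [if even k then \<sigma> (play_history \<sigma> \<tau> k) else \<tau> (play_history \<sigma> \<tau> k)]"

lemma length_play_history [simp]: "length (play_history \<sigma> \<tau> k) = k"
  by (induction k) auto

lemma legal_history_snoc:
  "legal_history m b X (h @ [S]) \<longleftrightarrow>
     legal_history m b X h \<and> legal_turn (turn_bias m b (length h)) (X - \<Union>(set h)) S"
  by (auto simp: legal_history_def nth_append less_Suc_eq)

text \<open>Here it matters that strategies are legal at every legal history: the history stays
  legal by induction, so the resulting play is legal.\<close>

lemma strategies_yield_play:
  assumes "maker_strategy m b X \<sigma>" "breaker_strategy m b X \<tau>"
  obtains T where "legal_play m b X T" "maker_follows \<sigma> T" "breaker_follows \<tau> T"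
proof -
  let ?H = "play_history \<sigma> \<tau>"
  define T where "T k = last (?H (Suc k))" for k
  have map_T: "map T [0..<k] = ?H k" for k
    by (induction k) (auto simp: T_def)
  have hist: "legal_history m b X (?H k)" for k
  proof (induction k)
    case 0
    then show ?case by (simp add: legal_history_def)
  next
    case (Suc k)
    then show ?case
      using assms by (simp add: legal_history_snoc turn_bias_def maker_strategy_def breaker_strategy_def)
  qed
  have "legal_turn (turn_bias m b k) (X - (\<Union>j<k. T j)) (T k)" for k
  proof -
    have "?H (Suc k) = map T [0..<k] @ [T k]" using map_T[of "Suc k"] by simp
    then show ?thesis
      using hist[of "Suc k"] by (simp only: legal_history_snoc) (simp add: atLeast0LessThan)
  qed
  then have "legal_play m b X T" by (simp add: legal_play_def)
  moreover have "maker_follows \<sigma> T" "breaker_follows \<tau> T"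
    unfolding maker_follows_def breaker_follows_def map_T by (simp_all add: T_def)
  ultimately show thesis using that by blast
qed

lemma maker_wins_within_imp_not_breaker_wins:
  assumes "maker_wins_within m b X \<F> t"
  shows "\<not> breaker_wins m b X \<F>"
proof
  assume "breaker_wins m b X \<F>"
  with assms obtain \<sigma> \<tau> where st: "maker_strategy m b X \<sigma>" "breaker_strategy m b X \<tau>"
    and \<sigma>: "\<And>T. legal_play m b X T \<Longrightarrow> maker_follows \<sigma> T \<Longrightarrow> \<exists>s\<le>t. \<exists>F\<in>\<F>. F \<subseteq> maker_claimed T s"
    and \<tau>: "\<And>T. legal_play m b X T \<Longrightarrow> breaker_follows \<tau> T \<Longrightarrow>
      \<not> (\<exists>t. \<exists>F\<in>\<F>. F \<subseteq> maker_claimed T t)"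
    unfolding maker_wins_within_def breaker_wins_def by metis
  obtain T where "legal_play m b X T" "maker_follows \<sigma> T" "breaker_follows \<tau> T"
    using strategies_yield_play[OF st] .
  then show False using \<sigma> \<tau> by blast
qed


subsection \<open>Finite cyclic orders\<close>

text \<open>Applied to \<open>ccw a\<close> and to its converse, this gives the first and the last
  point of a set in the order around \<open>a\<close>.\<close>

lemma finite_total_least:
  assumes "finite A" "A \<noteq> {}"
    and total: "\<And>x y. x \<in> A \<Longrightarrow> y \<in> A \<Longrightarrow> x \<noteq> y \<Longrightarrow> R x y \<or> R y x"
    and trans: "\<And>x y z. x \<in> A \<Longrightarrow> y \<in> A \<Longrightarrow> z \<in> A \<Longrightarrow> R x y \<Longrightarrow> R y z \<Longrightarrow> R x z"
  shows "\<exists>m\<in>A. \<forall>x\<in>A - {m}. R m x"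
proof -
  have "\<exists>m\<in>F. \<forall>x\<in>F - {m}. R m x" if "finite F" "F \<noteq> {}" "F \<subseteq> A" for F
    using that
  proof (induction F rule: finite_ne_induct)
    case (insert x F)
    then obtain m where m: "m \<in> F" "\<And>y. y \<in> F \<Longrightarrow> y \<noteq> m \<Longrightarrow> R m y" by auto
    show ?case
    proof (cases "R m x")
      case True
      then show ?thesis using m by (intro bexI[of _ m]) auto
    next
      case False
      then have "R x m" using total[of m x] insert.hyps insert.prems m by auto
      have "R x y" if "y \<in> F" for y
        using \<open>R x m\<close> m trans[of x m y] that insert.prems by (cases "y = m") auto
      then show ?thesis by (intro bexI[of _ x]) auto
    qed
  qed auto
  then show ?thesis using assms(1,2) by blast
qed

text \<open>The intended reading of \<open>ccw x y z\<close> is a left turn. Rotation and asymmetry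
  hold for arbitrary points of the plane, whereas totality and transitivity come from convex
  position, hence their restriction to \<open>V\<close>.\<close>

locale cyclic_order =
  fixes V :: "'a set" and ccw :: "'a \<Rightarrow> 'a \<Rightarrow> 'a \<Rightarrow> bool"
  assumes finite_V: "finite V"
    and ccw_rotate: "ccw x y z \<Longrightarrow> ccw y z x"
    and ccw_asym: "ccw x y z \<Longrightarrow> \<not> ccw x z y"
    and ccw_total: "\<lbrakk>x \<in> V; y \<in> V; z \<in> V; x \<noteq> y; x \<noteq> z; y \<noteq> z\<rbrakk> \<Longrightarrow> ccw x y z \<or> ccw x z y"
    and ccw_trans: "\<lbrakk>w \<in> V; x \<in> V; y \<in> V; z \<in> V; ccw w x y; ccw w y z\<rbrakk> \<Longrightarrow> ccw w x z"
begin

lemma ccw_distinct: "ccw x y z \<Longrightarrow> x \<noteq> y \<and> x \<noteq> z \<and> y \<noteq> z"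
  using ccw_rotate[of x y z] ccw_rotate[of y z x] ccw_asym[of x y z] ccw_asym[of y z x] ccw_asym[of z x y]
  by blast

lemma ccw_not_reverse: "ccw x y z \<Longrightarrow> \<not> ccw y x z"
  using ccw_rotate[of y x z] ccw_asym[of x y z] by blast

lemma ccw_rotate2: "ccw x y z \<Longrightarrow> ccw z x y"
  by (rule ccw_rotate[OF ccw_rotate])

text \<open>All other points of \<open>W\<close> lie to the left of the directed line ab, which
  makes ab a side of the polygon spanned by \<open>W\<close>. The parameter \<open>W\<close> gives
  access to the sides of each intermediate polygon.\<close>

definition succ_in :: "'a set \<Rightarrow> 'a \<Rightarrow> 'a \<Rightarrow> bool" where
  "succ_in W a b \<longleftrightarrow> a \<in> W \<and> b \<in> W \<and> a \<noteq> b \<and> (\<forall>w\<in>W - {a, b}. ccw a b w)"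

definition edge :: "'a set \<Rightarrow> 'a \<Rightarrow> 'a \<Rightarrow> bool" where
  "edge W a b \<longleftrightarrow> succ_in W a b \<or> succ_in W b a"

lemma edge_sym: "edge W a b \<Longrightarrow> edge W b a"
  by (auto simp: edge_def)

lemma edge_mono: "edge W a b \<Longrightarrow> W' \<subseteq> W \<Longrightarrow> a \<in> W' \<Longrightarrow> b \<in> W' \<Longrightarrow> edge W' a b"
  by (auto simp: edge_def succ_in_def)

lemma ex_first_ccw:
  assumes "a \<in> V" "A \<subseteq> V - {a}" "A \<noteq> {}"
  obtains s where "s \<in> A" "\<And>w. w \<in> A \<Longrightarrow> w \<noteq> s \<Longrightarrow> ccw a s w"
proof -
  have "\<exists>s\<in>A. \<forall>w\<in>A - {s}. ccw a s w"
  proof (rule finite_total_least)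
    show "finite A" using assms finite_V finite_subset by blast
    show "ccw a x y \<or> ccw a y x" if "x \<in> A" "y \<in> A" "x \<noteq> y" for x y
      using ccw_total[of a x y] that assms by auto
    show "ccw a x z" if "x \<in> A" "y \<in> A" "z \<in> A" "ccw a x y" "ccw a y z" for x y z
      using ccw_trans[of a x y z] that assms by auto
  qed (use assms in auto)
  then show thesis using that by auto
qed

lemma ex_last_ccw:
  assumes "a \<in> V" "A \<subseteq> V - {a}" "A \<noteq> {}"
  obtains p where "p \<in> A" "\<And>w. w \<in> A \<Longrightarrow> w \<noteq> p \<Longrightarrow> ccw a w p"
proof -
  have "\<exists>p\<in>A. \<forall>w\<in>A - {p}. ccw a w p"
  proof (rule finite_total_least)
    show "finite A" using assms finite_V finite_subset by blast
    show "ccw a y x \<or> ccw a x y" if "x \<in> A" "y \<in> A" "x \<noteq> y" for x y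
      using ccw_total[of a x y] that assms by auto
    show "ccw a z x" if "x \<in> A" "y \<in> A" "z \<in> A" "ccw a y x" "ccw a z y" for x y z
      using ccw_trans[of a z y x] that assms by auto
  qed (use assms in auto)
  then show thesis using that by auto
qed

lemma ex_succ_in:
  assumes "W \<subseteq> V" "a \<in> W" "W \<noteq> {a}"
  obtains s where "succ_in W a s"
proof -
  have "W - {a} \<noteq> {}" "a \<in> V" "W - {a} \<subseteq> V - {a}" using assms by auto
  from ex_first_ccw[OF this(2,3,1)] obtain s where
    "s \<in> W - {a}" "\<And>w. w \<in> W - {a} \<Longrightarrow> w \<noteq> s \<Longrightarrow> ccw a s w" by blast
  then have "succ_in W a s" using assms by (auto simp: succ_in_def)
  then show thesis using that by blast
qed

lemma ex_pred_in:
  assumes "W \<subseteq> V" "a \<in> W" "W \<noteq> {a}"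
  obtains p where "succ_in W p a"
proof -
  have "W - {a} \<noteq> {}" "a \<in> V" "W - {a} \<subseteq> V - {a}" using assms by auto
  from ex_last_ccw[OF this(2,3,1)] obtain p where
    "p \<in> W - {a}" "\<And>w. w \<in> W - {a} \<Longrightarrow> w \<noteq> p \<Longrightarrow> ccw a w p" by blast
  then have "succ_in W p a"
    using assms ccw_rotate[OF ccw_rotate] by (auto simp: succ_in_def)
  then show thesis using that by blast
qed

lemma succ_in_unique:
  assumes "succ_in W a b" "succ_in W a b'" shows "b = b'"
proof (rule ccontr)
  assume "b \<noteq> b'"
  then have "ccw a b b'" "ccw a b' b" using assms by (auto simp: succ_in_def)
  then show False using ccw_asym by blast
qed

lemma pred_in_unique:
  assumes "succ_in W a b" "succ_in W a' b" shows "a = a'"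
proof (rule ccontr)
  assume "a \<noteq> a'"
  then have "ccw a b a'" "ccw a' b a" using assms by (auto simp: succ_in_def)
  then show False using ccw_rotate[of a b a'] ccw_rotate[of b a' a] ccw_not_reverse[of a' b a]
    ccw_asym[of a' a b] by blast
qed

lemma edge_if_not_separated:
  assumes W: "W \<subseteq> V" "x \<in> W" "y \<in> W" "x \<noteq> y" "\<not> edge W x y"
  obtains w z where "w \<in> W" "z \<in> W" "ccw x y w" "ccw y x z"
proof -
  obtain z where "z \<in> W - {x, y}" "\<not> ccw x y z"
    using W unfolding edge_def succ_in_def by blast
  moreover obtain w where "w \<in> W - {x, y}" "\<not> ccw y x w"
    using W unfolding edge_def succ_in_def by blast
  ultimately have "ccw x y w" "ccw y x z"
    using ccw_total[of y x w] ccw_total[of x y z] ccw_rotate2[of y w x] ccw_rotate[of x z y]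
      ccw_rotate[of z y x] W by blast+
  then show thesis using that \<open>z \<in> W - {x, y}\<close> \<open>w \<in> W - {x, y}\<close> by blast
qed

lemma not_edge_if_separated:
  assumes "w \<in> W" "z \<in> W" "ccw x y w" "ccw y x z"
  shows "\<not> edge W x y"
proof
  assume "edge W x y"
  then have "ccw x y z \<or> ccw y x w"
    using assms ccw_distinct[of x y w] ccw_distinct[of y x z] by (auto simp: edge_def succ_in_def)
  then show False using assms ccw_not_reverse by blast
qed

lemma edge_if_card_3:
  assumes "W \<subseteq> V" "card W = 3" "x \<in> W" "y \<in> W" "x \<noteq> y"
  shows "edge W x y"
proof (rule ccontr)
  assume "\<not> edge W x y"
  then obtain w z where wz: "w \<in> W" "z \<in> W" "ccw x y w" "ccw y x z"
    using assms edge_if_not_separated by blast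
  then have "w \<noteq> z" using ccw_not_reverse by blast
  then have "card {x, y, w, z} = 4"
    using ccw_distinct[OF wz(3)] ccw_distinct[OF wz(4)] by auto
  moreover have "card {x, y, w, z} \<le> card W"
    using wz assms finite_V by (intro card_mono) (auto intro: finite_subset)
  ultimately show False using assms by simp
qed

text \<open>The line xy separates w from z. For points in convex position this amounts to crossing
  of the two chords.\<close>

definition cross :: "'a \<Rightarrow> 'a \<Rightarrow> 'a \<Rightarrow> 'a \<Rightarrow> bool" where
  "cross x y w z \<longleftrightarrow> ccw x y w \<and> ccw y x z \<or> ccw x y z \<and> ccw y x w"

text \<open>Transitivity around \<open>x\<close> in the order z, y, w and around \<open>y\<close> in
  the order w, x, z puts \<open>x\<close> and \<open>y\<close> on different sides of wz.\<close>

lemma cross_commute: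
  assumes "{x, y, w, z} \<subseteq> V" "cross x y w z" shows "cross w z x y"
proof -
  have *: "ccw z w x \<and> ccw w z y"
    if "ccw x y w" "ccw y x z" "{x, y, w, z} \<subseteq> V" for x y w z
  proof -
    have "ccw x z w"
      using ccw_trans[of x z y w] that ccw_rotate[OF that(2)] by simp
    moreover have "ccw y w z"
      using ccw_trans[of y w x z] that ccw_rotate[OF that(1)] by simp
    ultimately show ?thesis using ccw_rotate[of x z w] ccw_rotate[of y w z] by blast
  qed
  show ?thesis
    using assms *[of x y w z] *[of x y z w] unfolding cross_def by auto
qed

text \<open>The ear ps cuts off a alone, so it crosses all diagonals of W at a and no others.\<close>

context
  fixes W a p s
  assumes W: "W \<subseteq> V" and card_W: "card W \<ge> 4" and p: "succ_in W p a" and s: "succ_in W a s"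
begin

lemma ear_distinct: "p \<in> W" "a \<in> W" "s \<in> W" "p \<noteq> a" "a \<noteq> s" "p \<noteq> s"
proof -
  show 1: "p \<in> W" "a \<in> W" "s \<in> W" "p \<noteq> a" "a \<noteq> s" using p s by (auto simp: succ_in_def)
  have "\<not> W \<subseteq> {a, p}"
  proof
    assume "W \<subseteq> {a, p}"
    then have "card W \<le> card {a, p}" by (intro card_mono) auto
    then show False using card_W by (simp add: card_insert_if split: if_splits)
  qed
  then obtain w where w: "w \<in> W" "w \<noteq> a" "w \<noteq> p" by blast
  show "p \<noteq> s"
  proof
    assume "p = s"
    then have "ccw a p w" "ccw p a w" using p s w by (auto simp: succ_in_def)
    then show False using ccw_not_reverse by blast
  qed
qed

lemma ear_ccw: "ccw s p a"
proof -
  have "ccw p a s" using p ear_distinct by (auto simp: succ_in_def)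
  then show ?thesis by (rule ccw_rotate2)
qed

text \<open>Seen from \<open>w\<close>, the points \<open>p\<close>, \<open>a\<close>,
  \<open>s\<close> come in this order.\<close>

lemma ear_other_side:
  assumes "w \<in> W" "w \<noteq> p" "w \<noteq> a" "w \<noteq> s" shows "ccw p s w"
proof -
  have "ccw w a s" using s assms by (intro ccw_rotate2[of a s w]) (auto simp: succ_in_def)
  moreover have "ccw w p a" using p assms by (intro ccw_rotate2[of p a w]) (auto simp: succ_in_def)
  ultimately have "ccw w p s" using ccw_trans[of w p a s] assms ear_distinct W by blast
  then show ?thesis by (rule ccw_rotate)
qed

lemma not_edge_ear: "\<not> edge W p s"
proof -
  have "\<exists>w\<in>W. w \<noteq> p \<and> w \<noteq> a \<and> w \<noteq> s"
  proof (rule ccontr)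
    assume "\<not> ?thesis"
    then have "W \<subseteq> {p, a, s}" by blast
    then have "card W \<le> card {p, a, s}" by (intro card_mono) auto
    then show False using card_W by (simp add: card_insert_if split: if_splits)
  qed
  then show ?thesis
    using not_edge_if_separated[of _ W a p s] ear_other_side ear_ccw ear_distinct by blast
qed

lemma cross_ear:
  assumes "w \<in> W" "w \<noteq> p" "w \<noteq> a" "w \<noteq> s" shows "cross p s a w"
  using ear_other_side[OF assms] ear_ccw by (simp add: cross_def)

lemma not_cross_ear:
  assumes "x \<in> W - {a}" "y \<in> W - {a}" shows "\<not> cross p s x y"
proof -
  have "\<not> ccw s p w" if "w \<in> W - {a}" for w
    using that ear_other_side[of w] ccw_distinct[of s p w] ccw_not_reverse[of s p w] by blast
  then show ?thesis using assms by (auto simp: cross_def)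
qed

text \<open>If \<open>a\<close> lies to the left of xy as all the others do, xy was a side before.
  Otherwise \<open>a\<close> alone lies to the right, and \<open>p\<close>, \<open>s\<close> must be
  the ends of xy: a neighbour of \<open>a\<close> elsewhere would be joined to it by a side of
  \<open>W\<close> crossing xy.\<close>

lemma edge_cut_ear:
  assumes "edge (W - {a}) x y" shows "edge W x y \<or> {x, y} = {p, s}"
proof -
  have *: "edge W x y \<or> {x, y} = {p, s}" if e: "succ_in (W - {a}) x y" for x y
  proof (cases "ccw x y a")
    case True
    then show ?thesis using e by (auto simp: edge_def succ_in_def)
  next
    case False
    have xy: "x \<in> W" "y \<in> W" "x \<noteq> a" "y \<noteq> a" "x \<noteq> y"
      and xyw: "\<And>w. w \<in> W \<Longrightarrow> w \<noteq> a \<Longrightarrow> w \<noteq> x \<Longrightarrow> w \<noteq> y \<Longrightarrow> ccw x y w"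
      using e by (auto simp: succ_in_def)
    have xay: "ccw x a y" using False ccw_total[of x y a] xy ear_distinct W by blast
    have "p \<in> {x, y}"
    proof (rule ccontr)
      assume "p \<notin> {x, y}"
      then have "ccw x y p" "ccw p a x" using xyw p xy ear_distinct by (auto simp: succ_in_def)
      moreover have "ccw x a p" using ccw_trans[of x a y p] xay xy calculation W ear_distinct by blast
      ultimately show False
        using ccw_rotate[of p a x] ccw_rotate2[of p a x] ccw_asym[of x p a] by blast
    qed
    moreover have "s \<in> {x, y}"
    proof (rule ccontr)
      assume "s \<notin> {x, y}"
      then have "ccw x y s" "ccw a s y" using xyw s xy ear_distinct by (auto simp: succ_in_def)
      moreover have "ccw y x s"
        using ccw_trans[of y x a s] ccw_rotate2[of x a y] ccw_rotate2[of a s y] xay xy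
          calculation W ear_distinct by blast
      ultimately show False using ccw_not_reverse by blast
    qed
    ultimately show ?thesis using ear_distinct by blast
  qed
  show ?thesis using assms *[of x y] *[of y x] edge_sym unfolding edge_def by blast
qed

end

end


subsection \<open>Orientation of vertices of a polygon\<close>

text \<open>Twice the signed area of the triangle xyz, positive iff the triangle is
  counterclockwise.\<close>

definition orient :: "real^2 \<Rightarrow> real^2 \<Rightarrow> real^2 \<Rightarrow> real" where
  "orient x y z = (y $ 1 - x $ 1) * (z $ 2 - x $ 2) - (y $ 2 - x $ 2) * (z $ 1 - x $ 1)"

lemma orient_rotate: "orient y z x = orient x y z"
  by (simp add: orient_def algebra_simps)

lemma orient_swap: "orient x z y = - orient x y z" "orient y x z = - orient x y z"
  by (simp_all add: orient_def algebra_simps)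

lemma orient_refl [simp]: "orient x y x = 0" "orient x y y = 0" "orient x x y = 0"
  by (simp_all add: orient_def)

lemma orient_affine:
  "orient u v ((1 - t) *\<^sub>R w + t *\<^sub>R x) = (1 - t) * orient u v w + t * orient u v x"
  by (simp add: orient_def algebra_simps)

lemma vec2_eqI: "x $ 1 = y $ 1 \<Longrightarrow> x $ 2 = y $ 2 \<Longrightarrow> x = (y :: real^2)"
  by (simp add: vec_eq_iff forall_2)

lemma orient_eq_0_imp_collinear:
  assumes "orient x y z = 0" shows "collinear {x, y, z}"
proof -
  have eq: "(z $ 2 - x $ 2) * (y $ 1 - x $ 1) = (z $ 1 - x $ 1) * (y $ 2 - x $ 2)"
    using assms by (simp add: orient_def mult.commute)
  then have "z - x = ((z $ 1 - x $ 1) / (y $ 1 - x $ 1)) *\<^sub>R (y - x)" if "y $ 1 \<noteq> x $ 1"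
    using that by (intro vec2_eqI) (simp_all add: nonzero_eq_divide_eq)
  moreover have "z - x = ((z $ 2 - x $ 2) / (y $ 2 - x $ 2)) *\<^sub>R (y - x)" if "y $ 2 \<noteq> x $ 2"
    using that eq by (intro vec2_eqI) (simp_all add: nonzero_eq_divide_eq)
  ultimately have "y - x = 0 \<or> (\<exists>c. z - x = c *\<^sub>R (y - x))"
    by (metis vec2_eqI right_minus_eq)
  then have "collinear {0, y - x, z - x}" using collinear_lemma by blast
  then have "collinear {y, x, z}" by (simp add: collinear_3[of y x z])
  then show ?thesis by (simp add: insert_commute)
qed

text \<open>The weights are the areas of the three triangles spanned by w and a side of xyz.\<close>

lemma surrounded_in_convex_hull:
  assumes "orient w x y > 0" "orient w y z > 0" "orient w z x > 0"
  shows "w \<in> convex hull {x, y, z}"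
proof -
  define d where "d = orient w y z + orient w z x + orient w x y"
  have d: "d > 0" using assms by (simp add: d_def)
  have "orient w y z *\<^sub>R x + orient w z x *\<^sub>R y + orient w x y *\<^sub>R z = d *\<^sub>R w"
    by (intro vec2_eqI) (simp_all add: d_def orient_def algebra_simps)
  then have "(1 / d) *\<^sub>R (orient w y z *\<^sub>R x + orient w z x *\<^sub>R y + orient w x y *\<^sub>R z) = w"
    using d by simp
  then have "w = (orient w y z / d) *\<^sub>R x + (orient w z x / d) *\<^sub>R y + (orient w x y / d) *\<^sub>R z"
    by (simp add: scaleR_add_right)
  moreover have "orient w y z / d + orient w z x / d + orient w x y / d = 1"
    using d by (simp add: d_def add_divide_distrib[symmetric])
  moreover have "orient w y z / d \<ge> 0" "orient w z x / d \<ge> 0" "orient w x y / d \<ge> 0"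
    using assms d by simp_all
  ultimately show ?thesis unfolding convex_hull_3 by blast
qed

text \<open>Again the weights are areas; both convex combinations give the intersection point.\<close>

lemma open_segments_meet:
  assumes "orient u v w > 0" "orient v u x > 0" "orient w x v > 0" "orient x w u > 0"
  shows "open_segment u v \<inter> open_segment w x \<noteq> {}"
proof -
  define d where "d = orient u v w + orient v u x"
  \<comment> \<open>Either diagonal splits the same quadrilateral, so the two sums of areas
    agree.\<close>
  have d': "d = orient w x v + orient x w u" by (simp add: d_def orient_def algebra_simps)
  have d: "d > 0" using assms by (simp add: d_def)
  let ?s = "orient x w u / d" and ?t = "orient u v w / d"
  have "d *\<^sub>R ((1 - ?s) *\<^sub>R u + ?s *\<^sub>R v) = orient w x v *\<^sub>R u + orient x w u *\<^sub>R v"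
    using d by (simp add: scaleR_add_right right_diff_distrib) (simp add: d')
  also have "\<dots> = orient v u x *\<^sub>R w + orient u v w *\<^sub>R x"
    by (intro vec2_eqI) (simp_all add: orient_def algebra_simps)
  also have "\<dots> = d *\<^sub>R ((1 - ?t) *\<^sub>R w + ?t *\<^sub>R x)"
    using d by (simp add: scaleR_add_right right_diff_distrib) (simp add: d_def)
  finally have "(1 - ?s) *\<^sub>R u + ?s *\<^sub>R v = (1 - ?t) *\<^sub>R w + ?t *\<^sub>R x"
    using d by simp
  moreover have "0 < ?s" "?s < 1" "0 < ?t" "?t < 1"
    using assms d d' by (auto simp: d_def)
  moreover have "u \<noteq> v" "w \<noteq> x" using assms by auto
  ultimately have "(1 - ?s) *\<^sub>R u + ?s *\<^sub>R v \<in> open_segment u v \<inter> open_segment w x"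
    unfolding Int_iff in_segment by blast
  then show ?thesis by blast
qed

section \<open>Vertices, sides and diagonals of a convex polygon in terms of the cyclic
  order\<close>

locale polygon =
  fixes C :: "(real^2) set"
  assumes polytope: "polytope C"
begin

abbreviation "V \<equiv> vertices C"

lemma finite_vertices: "finite V"
  unfolding vertices_def using polytope polytope_imp_polyhedron finite_polyhedron_extreme_points by blast

lemma convex_hull_vertices: "convex hull V = C"
  unfolding vertices_def
  by (rule Krein_Milman_Minkowski[symmetric])
    (simp_all add: polytope polytope_imp_compact polytope_imp_convex)

text \<open>Removing an extreme point leaves \<open>C\<close> convex, and what is left contains the
  hull of the other vertices.\<close>

lemma vertex_notin_hull:
  assumes "w \<in> V" "S \<subseteq> V - {w}" shows "w \<notin> convex hull S"
proof -
  have "convex (C - {w})"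
    using assms(1) extreme_point_of_stillconvex[OF polytope_imp_convex[OF polytope]]
    by (simp add: vertices_def)
  moreover have "S \<subseteq> C - {w}"
    using assms(2) by (auto simp: vertices_def extreme_point_of_def)
  ultimately have "convex hull S \<subseteq> C - {w}" by (simp add: hull_minimal)
  then show ?thesis by blast
qed

lemma orient_nonzero:
  assumes "x \<in> V" "y \<in> V" "z \<in> V" "x \<noteq> y" "x \<noteq> z" "y \<noteq> z"
  shows "orient x y z \<noteq> 0"
proof
  assume "orient x y z = 0"
  then have "collinear {x, y, z}" by (rule orient_eq_0_imp_collinear)
  then have "x \<in> convex hull {y, z} \<or> y \<in> convex hull {z, x} \<or> z \<in> convex hull {x, y}"
    by (simp add: collinear_between_cases between_mem_segment segment_convex_hull)
  then show False
    using vertex_notin_hull[of x "{y, z}"] vertex_notin_hull[of y "{z, x}"]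
      vertex_notin_hull[of z "{x, y}"] assms by auto
qed

text \<open>Transitivity is the point: were it to fail, \<open>x\<close>, \<open>y\<close>,
  \<open>z\<close> would surround \<open>w\<close>, which would then lie in the hull of other
  vertices.\<close>

sublocale cyclic_order V "\<lambda>x y z. 0 < orient x y z"
proof
  show "finite V" by (rule finite_vertices)
  show "0 < orient y z x" if "0 < orient x y z" for x y z
    using that by (simp add: orient_rotate)
  show "\<not> 0 < orient x z y" if "0 < orient x y z" for x y z
    using that orient_swap(1)[of x z y] by simp
  show "0 < orient x y z \<or> 0 < orient x z y"
    if "x \<in> V" "y \<in> V" "z \<in> V" "x \<noteq> y" "x \<noteq> z" "y \<noteq> z" for x y z
    using orient_nonzero[OF that] orient_swap(1)[of x z y] by auto
  show "0 < orient w x z" if V: "w \<in> V" "x \<in> V" "y \<in> V" "z \<in> V"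
    and wxy: "0 < orient w x y" and wyz: "0 < orient w y z" for w x y z
  proof (rule ccontr)
    assume not: "\<not> ?thesis"
    have distinct: "w \<noteq> x" "w \<noteq> y" "w \<noteq> z" using wxy wyz by auto
    have "x \<noteq> z" using wxy wyz orient_swap(1)[of w x y] by auto
    then have "orient w z x > 0"
      using not orient_nonzero[of w x z] V distinct orient_swap(1)[of w z x] by auto
    then have "w \<in> convex hull {x, y, z}" using wxy wyz by (simp add: surrounded_in_convex_hull)
    then show False using vertex_notin_hull[of w "{x, y, z}"] V distinct by auto
  qed
qed

lemma orient_eq_0_iff:
  assumes "u \<in> V" "v \<in> V" "w \<in> V" "u \<noteq> v"
  shows "orient u v w = 0 \<longleftrightarrow> w = u \<or> w = v"
  using assms orient_nonzero[of u v w] by auto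

lemma open_segments_meet_iff:
  assumes V: "u \<in> V" "v \<in> V" "w \<in> V" "x \<in> V" and "u \<noteq> v" "w \<noteq> x" "{u, v} \<noteq> {w, x}"
  shows "open_segment u v \<inter> open_segment w x \<noteq> {} \<longleftrightarrow> cross u v w x"
proof
  assume "cross u v w x"
  moreover have "open_segment u v \<inter> open_segment w x \<noteq> {}"
    if o: "0 < orient u v w" "0 < orient v u x" and V: "{u, v, w, x} \<subseteq> V" for u v w x
  proof -
    have "cross w x u v" using cross_commute[of u v w x] that by (auto simp: cross_def)
    \<comment> \<open>\<open>cross\<close> leaves two orientations open; in this one both summands
      on the right of the area identity would be negative.\<close>
    moreover have "\<not> (0 < orient w x u \<and> 0 < orient x w v)"
    proof
      assume *: "0 < orient w x u \<and> 0 < orient x w v"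
      have "orient u v w + orient v u x = orient w x v + orient x w u"
        by (simp add: orient_def algebra_simps)
      then show False using o * orient_swap(2)[of x w v] orient_swap(2)[of w x u] by auto
    qed
    ultimately show ?thesis
      using open_segments_meet[of u v w x] o by (auto simp: cross_def)
  qed
  ultimately show "open_segment u v \<inter> open_segment w x \<noteq> {}"
    using V unfolding cross_def by (metis bot.extremum insert_subset open_segment_commute)
next
  assume "open_segment u v \<inter> open_segment w x \<noteq> {}"
  then obtain p where "p \<in> open_segment u v" "p \<in> open_segment w x" by blast
  then obtain s t where st: "0 < t" "t < 1"
    "p = (1 - s) *\<^sub>R u + s *\<^sub>R v" "p = (1 - t) *\<^sub>R w + t *\<^sub>R x"
    unfolding in_segment by blast
  \<comment> \<open>The affine function \<open>orient u v\<close> vanishes at \<open>p\<close>,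
    strictly between \<open>w\<close> and \<open>x\<close>, so its values at \<open>w\<close> and
    \<open>x\<close> are both zero or have opposite signs.\<close>
  have "orient u v p = 0" unfolding st(3) orient_affine by simp
  then have sum0: "(1 - t) * orient u v w + t * orient u v x = 0" unfolding st(4) orient_affine .
  have neg: "orient u v y < 0 \<longleftrightarrow> 0 < orient v u y" for y using orient_swap(2)[of u v y] by auto
  consider "orient u v w = 0" | "0 < orient u v w" | "orient u v w < 0" by linarith
  then show "cross u v w x"
  proof cases
    case 1
    then have "orient u v x = 0" using sum0 st by simp
    then have "w \<in> {u, v}" "x \<in> {u, v}" using 1 orient_eq_0_iff V \<open>u \<noteq> v\<close> by auto
    then show ?thesis using \<open>w \<noteq> x\<close> \<open>{u, v} \<noteq> {w, x}\<close> by auto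
  next
    case 2
    then have "t * orient u v x < 0" using sum0 st by (smt (verit) mult_pos_pos)
    then have "orient u v x < 0" using st by (simp add: mult_less_0_iff)
    then show ?thesis using 2 neg by (simp add: cross_def)
  next
    case 3
    then have "t * orient u v x > 0" using sum0 st by (smt (verit) mult_pos_neg)
    then have "orient u v x > 0" using st by (simp add: zero_less_mult_iff)
    then show ?thesis using 3 neg by (simp add: cross_def)
  qed
qed

lemma crossing_iff_cross:
  assumes V: "u \<in> V" "v \<in> V" "w \<in> V" "x \<in> V" and "u \<noteq> v" "w \<noteq> x"
  shows "crossing (closed_segment u v) (closed_segment w x) \<longleftrightarrow> cross u v w x"
proof (cases "{u, v} = {w, x}")
  case True
  then have "\<not> cross u v w x" by (auto simp: cross_def doubleton_eq_iff)
  moreover have "closed_segment u v = closed_segment w x" using True by simp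
  ultimately show ?thesis by (simp add: crossing_def)
next
  case False
  then have "closed_segment u v \<noteq> closed_segment w x" by simp
  then show ?thesis
    using open_segments_meet_iff[OF assms False] assms
    by (simp add: crossing_def rel_interior_closed_segment)
qed

text \<open>The other vertices lie in an open half-plane bounded by the line uv, so their hull
  misses this line.\<close>

lemma segment_face_if_succ_in:
  assumes "succ_in V u v"
  shows "closed_segment u v face_of C"
proof -
  have uv: "u \<in> V" "v \<in> V" "u \<noteq> v" using assms by (auto simp: succ_in_def)
  have "convex {p. orient u v p > 0}"
  proof (rule convexI)
    fix x y and a b :: real
    assume *: "x \<in> {p. orient u v p > 0}" "y \<in> {p. orient u v p > 0}" "0 \<le> a" "0 \<le> b" "a + b = 1"
    then have a: "a = 1 - b" by simp
    have "0 < a * orient u v x + b * orient u v y"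
      using * by (cases "a = 0") (auto intro: add_pos_nonneg)
    then show "a *\<^sub>R x + b *\<^sub>R y \<in> {p. orient u v p > 0}"
      unfolding a mem_Collect_eq orient_affine .
  qed
  moreover have "V - {u, v} \<subseteq> {p. orient u v p > 0}" using assms by (auto simp: succ_in_def)
  ultimately have 1: "convex hull (V - {u, v}) \<subseteq> {p. orient u v p > 0}" by (simp add: hull_minimal)
  have 2: "orient u v p = 0" if p: "p \<in> affine hull {u, v}" for p
  proof -
    obtain a b where "p = a *\<^sub>R u + b *\<^sub>R v" "a + b = 1" using p unfolding affine_hull_2 by blast
    then have "p = (1 - b) *\<^sub>R u + b *\<^sub>R v" by (simp add: eq_diff_eq[symmetric])
    then show ?thesis by (simp only: orient_affine) simp
  qed
  have "affine hull {u, v} \<inter> convex hull (V - {u, v}) = {}" using 1 2 by fastforce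
  then have "convex hull {u, v} face_of convex hull V"
    using face_of_convex_hulls[OF finite_vertices, of "{u, v}"] uv by simp
  then show ?thesis by (simp add: segment_convex_hull convex_hull_vertices)
qed

text \<open>If vertices \<open>w\<close> and \<open>z\<close> lay on both sides of a one-dimensional
  face uv, the segment wz would meet it in an interior point, and the face property would force
  \<open>w\<close> into uv.\<close>

lemma edge_iff_adjacent:
  assumes uv: "u \<in> V" "v \<in> V" "u \<noteq> v"
  shows "adjacent_vertices C u v \<longleftrightarrow> edge V u v"
proof
  assume "edge V u v"
  then have "closed_segment u v face_of C"
    using segment_face_if_succ_in[of u v] segment_face_if_succ_in[of v u]
    by (auto simp: edge_def closed_segment_commute)
  moreover have "aff_dim (closed_segment u v) = 1"
    using uv by (simp add: segment_convex_hull aff_dim_convex_hull aff_dim_2)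
  ultimately show "adjacent_vertices C u v" using uv by (simp add: adjacent_vertices_def edge_of_def)
next
  assume "adjacent_vertices C u v"
  then have face: "closed_segment u v face_of C" by (simp add: adjacent_vertices_def edge_of_def)
  show "edge V u v"
  proof (rule ccontr)
    assume "\<not> edge V u v"
    then obtain w z where wz: "w \<in> V" "z \<in> V" "0 < orient u v w" "0 < orient v u z"
      using edge_if_not_separated[of V u v] uv by blast
    have ne: "w \<noteq> u" "w \<noteq> v" "w \<noteq> z"
      using wz orient_swap(2)[of u v w] by auto
    have "cross u v w z" using wz by (simp add: cross_def)
    then obtain p where "p \<in> open_segment u v" "p \<in> open_segment w z"
      using open_segments_meet_iff[of u v w z] uv wz ne by blast
    then have "w \<in> closed_segment u v"
      using face_ofD[OF face] wz segment_open_subset_closed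
      by (metis (no_types, lifting) extreme_point_of_def mem_Collect_eq subsetD vertices_def)
    then show False
      using vertex_notin_hull[of w "{u, v}"] uv wz ne by (auto simp: segment_convex_hull)
  qed
qed

lemma diagonals_eq:
  "diagonals C = {closed_segment u v | u v. u \<in> V \<and> v \<in> V \<and> u \<noteq> v \<and> \<not> edge V u v}"
  unfolding diagonals_def using edge_iff_adjacent by blast

lemma finite_diagonals: "finite (diagonals C)"
proof -
  have "diagonals C \<subseteq> (\<lambda>(u, v). closed_segment u v) ` (V \<times> V)" by (auto simp: diagonals_eq)
  then show ?thesis using finite_vertices finite_subset by blast
qed

end


subsection \<open>Triangles of a triangulation\<close>

lemma crossing_commute: "crossing d e \<longleftrightarrow> crossing e d"
  by (auto simp: crossing_def)

lemma legal_turn_1_unique: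
  assumes "legal_turn 1 U S" "finite U" "d \<in> S" "e \<in> S" shows "d = e"
proof -
  have "finite S" "card S \<le> 1" using assms by (auto simp: legal_turn_def intro: finite_subset)
  then show ?thesis using assms by (auto simp: card_le_Suc0_iff_eq)
qed

lemma not_crossing_refl: "\<not> crossing d d"
  by (simp add: crossing_def)

lemma ex_notin_if_card_less:
  assumes "finite B" "card B < card A" shows "\<exists>x\<in>A. x \<notin> B"
  using assms card_mono[of B A] by (meson not_le subsetI)

context polygon
begin

lemma segment_in_diagonals_iff:
  "closed_segment u v \<in> diagonals C \<longleftrightarrow> u \<in> V \<and> v \<in> V \<and> u \<noteq> v \<and> \<not> edge V u v"
proof
  assume "closed_segment u v \<in> diagonals C"
  then obtain x y where xy: "{u, v} = {x, y}" "x \<in> V" "y \<in> V" "x \<noteq> y" "\<not> edge V x y"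
    by (auto simp: diagonals_eq)
  then consider "u = x" "v = y" | "u = y" "v = x" by (meson doubleton_eq_iff)
  then show "u \<in> V \<and> v \<in> V \<and> u \<noteq> v \<and> \<not> edge V u v"
    using xy edge_sym[of V u v] by cases auto
qed (auto simp: diagonals_eq)

lemma succ_in_asym:
  assumes "card V \<ge> 3" "succ_in V a b" shows "\<not> succ_in V b a"
proof
  assume ba: "succ_in V b a"
  have "card {a, b} < card V" using assms by (simp add: card_insert_if)
  then obtain w where "w \<in> V" "w \<notin> {a, b}" using ex_notin_if_card_less[of "{a, b}" V] by auto
  then have "0 < orient a b w" "0 < orient b a w" using assms(2) ba by (auto simp: succ_in_def)
  then show False using ccw_not_reverse by blast
qed

text \<open>The apex is the vertex nearest to \<open>b\<close>, in the order around
  \<open>a\<close>, among those joined to \<open>a\<close>. If bc were missing, maximality would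
  give a diagonal xy in \<open>F\<close> crossing bc, with \<open>y\<close> beyond bc. Either x = a,
  and then \<open>y\<close> is joined to \<open>a\<close> and precedes \<open>c\<close>, or xy
  crosses ac as well, impossible for a side and for a member of \<open>F\<close>.\<close>

lemma triangulation_triangle:
  assumes card_V: "card V \<ge> 3" and F: "F \<in> triangulations C" and ab: "succ_in V a b"
  obtains c where "c \<in> V" "c \<noteq> a" "c \<noteq> b" "edge V a c \<or> closed_segment a c \<in> F"
    "edge V b c \<or> closed_segment b c \<in> F"
proof -
  have V: "a \<in> V" "b \<in> V" "a \<noteq> b" using ab by (auto simp: succ_in_def)
  have family: "noncrossing_family C F"
    and maximal: "\<And>E. noncrossing_family C E \<Longrightarrow> F \<subseteq> E \<Longrightarrow> E = F"
    using F by (auto simp: triangulations_def)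
  have "F \<subseteq> diagonals C" using family by (simp add: noncrossing_family_def)
  moreover have "\<not> crossing d e" if "d \<in> F" "e \<in> F" for d e
    using family that not_crossing_refl by (cases "d = e") (auto simp: noncrossing_family_def pairwise_def)
  ultimately have noncrossing: "F \<subseteq> diagonals C"
    "\<And>d e. d \<in> F \<Longrightarrow> e \<in> F \<Longrightarrow> \<not> crossing d e" by auto
  define A where "A = {c \<in> V - {a, b}. edge V a c \<or> closed_segment a c \<in> F}"
  have "V \<noteq> {a}" using V by auto
  then obtain p where p: "succ_in V p a"
    using ex_pred_in[of V a] V by blast
  have "p \<noteq> b" using succ_in_asym[OF card_V ab] p by auto
  then have "p \<in> A" using p by (auto simp: A_def edge_def succ_in_def)
  then obtain c where c: "c \<in> A" and first: "\<And>w. w \<in> A \<Longrightarrow> w \<noteq> c \<Longrightarrow> 0 < orient a c w"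
    using ex_first_ccw[of a A] V by (auto simp: A_def)
  then have cV: "c \<in> V" "c \<noteq> a" "c \<noteq> b" by (auto simp: A_def)
  have abc: "0 < orient a b c" using ab cV by (auto simp: succ_in_def)
  have False if not_edge: "\<not> edge V b c" and not_F: "closed_segment b c \<notin> F"
  proof -
    have bc: "closed_segment b c \<in> diagonals C"
      using not_edge cV V by (simp add: segment_in_diagonals_iff)
    have "\<not> noncrossing_family C (insert (closed_segment b c) F)"
      using maximal not_F by blast
    then obtain d where d: "d \<in> F" "crossing (closed_segment b c) d"
      using noncrossing bc unfolding noncrossing_family_def pairwise_insert
      by (auto simp: pairwise_def crossing_commute)
    then obtain x y where xy: "d = closed_segment x y" "x \<in> V" "y \<in> V" "x \<noteq> y"
      using noncrossing(1) by (auto simp: diagonals_eq)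
    have "cross b c x y" using d xy cV V by (simp add: crossing_iff_cross)
    then obtain x y where xy: "closed_segment x y \<in> F" "x \<in> V" "y \<in> V" "x \<noteq> y"
      and bcx: "0 < orient b c x" and cby: "0 < orient c b y"
      using d xy unfolding cross_def by (metis closed_segment_commute)
    have cay: "0 < orient c a y"
      using ccw_trans[of c a b y] ccw_rotate2[OF abc] cby V cV xy by blast
    have ne: "x \<noteq> b" "x \<noteq> c" "y \<noteq> a" "y \<noteq> b" "y \<noteq> c" using bcx cby cay by auto
    have "x \<noteq> a"
    proof
      assume "x = a"
      then have "y \<in> A" using xy ne by (auto simp: A_def)
      then have "0 < orient a c y" using first ne by blast
      then show False using cay ccw_not_reverse by blast
    qed
    \<comment> \<open>Otherwise \<open>x\<close> would lie on the inner side of all three edges of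
      abc, against convex position.\<close>
    have not_cax: "\<not> 0 < orient c a x"
    proof
      assume "0 < orient c a x"
      then have "0 < orient x c a" by (rule ccw_rotate2)
      moreover have "0 < orient x b c" using bcx by (rule ccw_rotate2)
      ultimately have "0 < orient x b a" using ccw_trans[of x b c a] xy V cV by blast
      moreover have "0 < orient x a b"
        using ab xy ne \<open>x \<noteq> a\<close> by (intro ccw_rotate2[of a b x]) (auto simp: succ_in_def)
      ultimately show False using ccw_asym by blast
    qed
    then have "0 < orient a c x"
      using ccw_total[of c a x] ccw_rotate2[of c x a] V cV xy ne \<open>x \<noteq> a\<close> by blast
    then have "cross a c x y" using cay by (simp add: cross_def)
    then have "crossing (closed_segment a c) (closed_segment x y)"
      using V cV xy by (simp add: crossing_iff_cross)
    moreover have "\<not> edge V a c"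
    proof
      assume "edge V a c"
      then have "succ_in V c a" using succ_in_unique[OF ab, of c] cV by (auto simp: edge_def)
      then show False using not_cax xy ne \<open>x \<noteq> a\<close> by (auto simp: succ_in_def)
    qed
    ultimately show False
      using c noncrossing(2)[OF _ xy(1)] unfolding A_def by blast
  qed
  then show thesis using that[of c] c cV by (auto simp: A_def)
qed


subsection \<open>Maker cuts off ears\<close>

text \<open>\<open>M\<close> triangulates the part of \<open>C\<close> outside the polygon spanned
  by \<open>W\<close>. The last clause is maximality at the vertices already cut off; the clause
  before it says that Maker owns no diagonal of \<open>W\<close>, so the next ear is still open to
  her.\<close>

definition partial_triangulation :: "(real^2) set set \<Rightarrow> (real^2) set \<Rightarrow> bool" where
  "partial_triangulation M W \<longleftrightarrow> M \<subseteq> diagonals C \<and> W \<subseteq> V \<and>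
     (\<forall>d\<in>M. \<forall>e\<in>M. \<not> crossing d e) \<and>
     (\<forall>d\<in>M. \<forall>x\<in>W. \<forall>y\<in>W. x \<noteq> y \<longrightarrow> \<not> crossing d (closed_segment x y)) \<and>
     (\<forall>x\<in>W. \<forall>y\<in>W. edge W x y \<longrightarrow> edge V x y \<or> closed_segment x y \<in> M) \<and>
     (\<forall>x\<in>W. \<forall>y\<in>W. closed_segment x y \<in> M \<longrightarrow> edge W x y) \<and>
     (\<forall>x\<in>V - W. \<forall>y\<in>V. x \<noteq> y \<longrightarrow>
        edge V x y \<or> closed_segment x y \<in> M \<or> (\<exists>d\<in>M. crossing d (closed_segment x y)))"

lemma partial_triangulationD:
  assumes "partial_triangulation M W"
  shows "M \<subseteq> diagonals C" "W \<subseteq> V"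
    and "\<And>d e. d \<in> M \<Longrightarrow> e \<in> M \<Longrightarrow> \<not> crossing d e"
    and "\<And>d x y. d \<in> M \<Longrightarrow> x \<in> W \<Longrightarrow> y \<in> W \<Longrightarrow> x \<noteq> y \<Longrightarrow> \<not> crossing d (closed_segment x y)"
    and "\<And>x y. x \<in> W \<Longrightarrow> y \<in> W \<Longrightarrow> edge W x y \<Longrightarrow> edge V x y \<or> closed_segment x y \<in> M"
    and "\<And>x y. x \<in> W \<Longrightarrow> y \<in> W \<Longrightarrow> closed_segment x y \<in> M \<Longrightarrow> edge W x y"
    and "\<And>x y. x \<in> V \<Longrightarrow> x \<notin> W \<Longrightarrow> y \<in> V \<Longrightarrow> x \<noteq> y \<Longrightarrow>
      edge V x y \<or> closed_segment x y \<in> M \<or> (\<exists>d\<in>M. crossing d (closed_segment x y))"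
  using assms unfolding partial_triangulation_def by blast+

lemma partial_triangulation_cut_ear:
  assumes MW: "partial_triangulation M W" and card_W: "card W \<ge> 4"
    and p: "succ_in W p a" and s: "succ_in W a s"
  shows "closed_segment p s \<in> diagonals C - M"
    and "partial_triangulation (insert (closed_segment p s) M) (W - {a})"
proof -
  note D = partial_triangulationD[OF MW]
  note ear = ear_distinct[OF D(2) card_W p s]
  have not_edge: "\<not> edge W p s" using not_edge_ear[OF D(2) card_W p s] .
  then have "\<not> edge V p s" using edge_mono[of V p s W] D(2) ear by blast
  then have ps: "closed_segment p s \<in> diagonals C"
    using ear D(2) by (auto simp: segment_in_diagonals_iff)
  then show "closed_segment p s \<in> diagonals C - M" using D(6) ear not_edge by blast
  have cross_iff: "crossing (closed_segment p s) (closed_segment x y) \<longleftrightarrow> cross p s x y"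
    if "x \<in> W" "y \<in> W" "x \<noteq> y" for x y
    using that ear D(2) by (intro crossing_iff_cross) auto
  have "succ_in (W - {a}) p s"
    using ear_other_side[OF D(2) card_W p s] ear unfolding succ_in_def by auto
  then have edge_ps: "edge (W - {a}) p s" "edge (W - {a}) s p" by (auto simp: edge_def)
  show "partial_triangulation (insert (closed_segment p s) M) (W - {a})"
    unfolding partial_triangulation_def
  proof (intro conjI ballI impI)
    show "insert (closed_segment p s) M \<subseteq> diagonals C" using ps D(1) by blast
    show "W - {a} \<subseteq> V" using D(2) by blast
    show "\<not> crossing d e"
      if "d \<in> insert (closed_segment p s) M" "e \<in> insert (closed_segment p s) M" for d e
      using that D(3)[of d e] D(4)[of d p s] D(4)[of e p s] ear(1,3,6) crossing_commute[of d e]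
        not_crossing_refl[of d] by auto
    show "\<not> crossing d (closed_segment x y)"
      if "d \<in> insert (closed_segment p s) M" "x \<in> W - {a}" "y \<in> W - {a}" "x \<noteq> y" for d x y
      using that D(4)[of d x y] cross_iff[of x y] not_cross_ear[OF D(2) card_W p s, of x y] by auto
    show "edge V x y \<or> closed_segment x y \<in> insert (closed_segment p s) M"
      if "x \<in> W - {a}" "y \<in> W - {a}" "edge (W - {a}) x y" for x y
      using that D(5)[of x y] edge_cut_ear[OF D(2) card_W p s, of x y] by auto
    show "edge (W - {a}) x y"
      if "x \<in> W - {a}" "y \<in> W - {a}" "closed_segment x y \<in> insert (closed_segment p s) M" for x y
      using that D(6)[of x y] edge_mono[of W x y "W - {a}"] edge_ps
      by (auto simp: doubleton_eq_iff)
    show "edge V x y \<or> closed_segment x y \<in> insert (closed_segment p s) M \<or>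
        (\<exists>d\<in>insert (closed_segment p s) M. crossing d (closed_segment x y))"
      if xy: "x \<in> V - (W - {a})" "y \<in> V" "x \<noteq> y" for x y
    proof -
      \<comment> \<open>The new pairs are those joining \<open>a\<close> to the rest of
        \<open>W\<close>: to \<open>p\<close> and \<open>s\<close> by sides of \<open>W\<close>, to
        all others by segments crossing ps.\<close>
      consider "x \<notin> W" | "y \<notin> W" "x = a" | "x = a" "y \<in> {p, s}" | "x = a" "y \<in> W" "y \<notin> {p, s}"
        using xy by blast
      then show ?thesis
      proof cases
        case 1
        then show ?thesis using D(7)[of x y] xy by blast
      next
        case 2
        then show ?thesis
          using D(7)[of y x] xy edge_sym[of V y x] by (auto simp: closed_segment_commute)
      next
        case 3
        then have "edge W x y" using p s by (auto simp: edge_def)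
        then show ?thesis using D(5)[of x y] ear 3 by auto
      next
        case 4
        then have "cross p s x y" using cross_ear[OF D(2) card_W p s, of y] xy by auto
        then show ?thesis using cross_iff[of x y] 4 ear xy by auto
      qed
    qed
  qed
qed

text \<open>Pairs inside a triangle \<open>W\<close> are sides of it, hence sides of
  \<open>C\<close> or claimed, and all other pairs fall under the maximality clause. So a diagonal
  crossing nothing in \<open>M\<close> belongs to \<open>M\<close>.\<close>

lemma partial_triangulation_triangle:
  assumes MW: "partial_triangulation M W" and card_W: "card W = 3"
  shows "M \<in> triangulations C"
proof -
  note D = partial_triangulationD[OF MW]
  have "E = M" if E: "noncrossing_family C E" "M \<subseteq> E" for E
  proof -
    have "e \<in> M" if e: "e \<in> E" for e
    proof -
      obtain x y where xy: "e = closed_segment x y" "x \<in> V" "y \<in> V" "x \<noteq> y" "\<not> edge V x y"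
        using e E(1) unfolding noncrossing_family_def diagonals_eq by blast
      have "\<not> crossing d e" if "d \<in> M" for d
        using E that e unfolding noncrossing_family_def pairwise_def crossing_def by blast
      then show ?thesis
        using D(5)[of x y] edge_if_card_3[OF D(2) card_W, of x y] D(7)[of x y] D(7)[of y x]
          xy edge_sym[of V y x] by (auto simp: closed_segment_commute)
    qed
    then show ?thesis using E by blast
  qed
  moreover have "noncrossing_family C M"
    using D(1,3) by (auto simp: noncrossing_family_def pairwise_def)
  ultimately show ?thesis by (auto simp: triangulations_def)
qed

text \<open>
  Before each of her turns, Breaker's diagonals inside the remaining polygon W all have a common
  endpoint a, so cutting off the ear at a removes them all.
\<close>

definition maker_invariant :: "nat \<Rightarrow> (real^2) set set \<Rightarrow> (real^2) set set \<Rightarrow> bool" where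
  "maker_invariant t M B \<longleftrightarrow> (\<exists>W a. partial_triangulation M W \<and> card W + t = card V \<and> a \<in> W \<and>
     (\<forall>x\<in>W. \<forall>y\<in>W. x \<noteq> y \<and> closed_segment x y \<in> B \<and> \<not> edge W x y \<longrightarrow> a \<in> {x, y}))"

lemma maker_wins_unbiased:
  assumes card_V: "card V \<ge> 3"
  shows "maker_wins_within 1 1 (diagonals C) (triangulations C) (card V - 3)"
proof (rule maker_wins_withinI[where I = maker_invariant])
  show "finite (diagonals C)" by (rule finite_diagonals)
  have "V \<noteq> {}" using card_V by auto
  then show "maker_invariant 0 {} {}"
    unfolding maker_invariant_def partial_triangulation_def by (intro exI[of _ V]) auto
  show "\<exists>F\<in>triangulations C. F \<subseteq> M" if "maker_invariant (card V - 3) M B" for M B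
    using that card_V partial_triangulation_triangle unfolding maker_invariant_def
    by (metis add_left_cancel add.commute le_add_diff_inverse order_refl)
  fix t M B
  assume t: "t < card V - 3" and inv: "maker_invariant t M B"
  let ?U = "diagonals C - (M \<union> B)"
  from inv obtain W a where MW: "partial_triangulation M W" and card_W: "card W + t = card V"
    and a: "a \<in> W" and B: "\<And>x y. x \<in> W \<Longrightarrow> y \<in> W \<Longrightarrow> x \<noteq> y \<Longrightarrow> closed_segment x y \<in> B \<Longrightarrow>
      \<not> edge W x y \<Longrightarrow> a \<in> {x, y}"
    unfolding maker_invariant_def by blast
  have W: "W \<subseteq> V" "card W \<ge> 4" "W \<noteq> {a}"
    using partial_triangulationD(2)[OF MW] t card_W by auto
  obtain p where p: "succ_in W p a" using ex_pred_in W a by blast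
  obtain s where s: "succ_in W a s" using ex_succ_in W a by blast
  note ear = ear_distinct[OF W(1,2) p s]
  let ?d = "closed_segment p s"
  \<comment> \<open>A diagonal of \<open>W\<close> in \<open>B\<close> ends at \<open>a\<close>, but
    ps does not.\<close>
  have "?d \<notin> B" using B[of p s] ear not_edge_ear[OF W(1,2) p s] by auto
  then have d: "?d \<in> ?U" using partial_triangulation_cut_ear(1)[OF MW W(2) p s] by blast
  then have "card ?U \<noteq> 0" using finite_diagonals by auto
  then have "legal_turn 1 ?U {?d}" using d by (simp add: legal_turn_def)
  moreover have "maker_invariant (Suc t) (M \<union> {?d}) (B \<union> S')"
    if S': "legal_turn 1 (?U - {?d}) S'" for S'
  proof -
    let ?W = "W - {a}"
    have S'_eq: "d = e" if "d \<in> S'" "e \<in> S'" for d e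
      using legal_turn_1_unique[OF S' _ that] finite_diagonals by simp
    have in_S': "closed_segment x y \<in> S'"
      if "x \<in> ?W" "y \<in> ?W" "x \<noteq> y" "closed_segment x y \<in> B \<union> S'" "\<not> edge ?W x y" for x y
      using that B[of x y] edge_mono[of W x y ?W] by blast
    have "\<exists>b\<in>?W. \<forall>x\<in>?W. \<forall>y\<in>?W. x \<noteq> y \<and> closed_segment x y \<in> B \<union> S' \<and> \<not> edge ?W x y \<longrightarrow> b \<in> {x, y}"
    \<comment> \<open>By \<open>in_S'\<close> only Breaker's latest diagonal can matter in the cut
      polygon. Either of its ends may become the next common endpoint; without such a diagonal any
      vertex will do.\<close>
    proof (cases "\<exists>x\<in>?W. \<exists>y\<in>?W. closed_segment x y \<in> S'")
      case True
      then obtain b c where bc: "b \<in> ?W" "closed_segment b c \<in> S'" by blast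
      have "b \<in> {x, y}" if "closed_segment x y \<in> S'" for x y
        using S'_eq[OF that bc(2)] by (auto simp: doubleton_eq_iff)
      then show ?thesis using bc(1) in_S' by blast
    next
      case False
      then show ?thesis using in_S' ear by blast
    qed
    moreover have "card ?W + Suc t = card V"
      using card_W a W(2) by (simp add: card_Diff_singleton_if)
    ultimately show ?thesis
      using partial_triangulation_cut_ear(2)[OF MW W(2) p s] unfolding maker_invariant_def by auto
  qed
  ultimately show "\<exists>S. legal_turn 1 ?U S \<and>
      (\<forall>S'. legal_turn 1 (?U - S) S' \<longrightarrow> maker_invariant (Suc t) (M \<union> S) (B \<union> S'))"
    by blast
qed


subsection \<open>Breaker spoils every triangle at one side\<close>

text \<open>K consists of the apexes c for which neither diagonal of the triangle abc is claimed yet.\<close>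

definition spoiling where
  "spoiling a b K M B \<longleftrightarrow> B \<subseteq> diagonals C \<and> succ_in V a b \<and> K \<subseteq> V - {a, b} \<and>
     (\<forall>c\<in>V - {a, b} - K. closed_segment a c \<in> B \<or> closed_segment b c \<in> B) \<and>
     (\<forall>c\<in>K. {closed_segment a c, closed_segment b c} \<subseteq> diagonals C - (M \<union> B))"

text \<open>The side ab depends on Maker's first diagonal, so the initial position is a separate
  case. After one round at most n - 4 apexes are left, and each further round removes one while any
  remain.\<close>

definition breaker_invariant :: "nat \<Rightarrow> (real^2) set set \<Rightarrow> (real^2) set set \<Rightarrow> bool" where
  "breaker_invariant t M B \<longleftrightarrow> t = 0 \<and> M = {} \<and> B = {} \<or>
     (\<exists>a b K. spoiling a b K M B \<and> card K + t \<le> card V - 3)"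

lemma breaker_first_turn:
  assumes card_V: "card V \<ge> 5" and S: "legal_turn 1 (diagonals C) S"
  shows "\<exists>S'. legal_turn 2 (diagonals C - S) S' \<and> breaker_invariant (Suc 0) S S'"
proof -
  have "V \<noteq> {}" using card_V by auto
  obtain u v where uv: "u \<in> V" "v \<in> V" "S \<subseteq> {closed_segment u v}"
  proof (cases "S = {}")
    case True
    then show thesis using that \<open>V \<noteq> {}\<close> by blast
  next
    case False
    then obtain d where "d \<in> S" by blast
    then obtain u v where "d = closed_segment u v" "u \<in> V" "v \<in> V"
      using S by (auto simp: legal_turn_def diagonals_eq)
    moreover have "S \<subseteq> {d}"
      using legal_turn_1_unique[OF S finite_diagonals _ \<open>d \<in> S\<close>] by blast
    ultimately show thesis using that by blast
  qed
  have V_ne: "V \<noteq> {x}" for x using card_V by auto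
  obtain u' where u': "succ_in V u' u" using ex_pred_in[of V u] uv V_ne by blast
  obtain v' where v': "succ_in V v' v" using ex_pred_in[of V v] uv V_ne by blast
  \<comment> \<open>Avoiding the ends of Maker's diagonal keeps \<open>a\<close> off it; avoiding
    their predecessors keeps the successor \<open>b\<close> off it. Four excluded vertices leave a
    fifth.\<close>
  have "card {u, v, u', v'} < card V" using card_V by (simp add: card_insert_if)
  then obtain a where a: "a \<in> V" "a \<noteq> u" "a \<noteq> v" "a \<noteq> u'" "a \<noteq> v'"
    using ex_notin_if_card_less[of "{u, v, u', v'}" V] by auto
  obtain b where ab: "succ_in V a b" using ex_succ_in[of V a] a V_ne by blast
  then have b: "b \<in> V" "b \<noteq> u" "b \<noteq> v" "a \<noteq> b"
    using a pred_in_unique[OF u', of a] pred_in_unique[OF v', of a] by (auto simp: succ_in_def)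
  obtain q where q: "succ_in V q a" using ex_pred_in[of V a] a V_ne by blast
  obtain r where r: "succ_in V b r" using ex_succ_in[of V b] b V_ne by blast
  have qr: "q \<in> V" "r \<in> V" "q \<noteq> a" "r \<noteq> b" using q r by (auto simp: succ_in_def)
  have "q \<noteq> b" "r \<noteq> a" using succ_in_asym[OF _ ab] card_V q r by auto
  have next_ccw: "\<And>w. w \<in> V \<Longrightarrow> w \<noteq> a \<Longrightarrow> w \<noteq> b \<Longrightarrow> 0 < orient a b w"
    "\<And>w. w \<in> V \<Longrightarrow> w \<noteq> q \<Longrightarrow> w \<noteq> a \<Longrightarrow> 0 < orient q a w"
    "\<And>w. w \<in> V \<Longrightarrow> w \<noteq> b \<Longrightarrow> w \<noteq> r \<Longrightarrow> 0 < orient b r w"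
    using ab q r by (auto simp: succ_in_def)
  \<comment> \<open>If they coincided, abq would be bounded by sides only and leave no room for a
    fourth vertex.\<close>
  have "q \<noteq> r"
  proof
    assume "q = r"
    have "card {a, b, q} < card V" using card_V by (simp add: card_insert_if)
    then obtain w where w: "w \<in> V" "w \<noteq> a" "w \<noteq> b" "w \<noteq> q"
      using ex_notin_if_card_less[of "{a, b, q}" V] by auto
    then have "0 < orient w a b" "0 < orient w q a" "0 < orient w b q"
      using next_ccw[of w] ccw_rotate2 \<open>q = r\<close> by blast+
    then show False using ccw_trans[of w a b q] ccw_asym[of w q a] w a b qr by blast
  qed
  have diagonal_a: "closed_segment a c \<in> diagonals C"
    if "c \<in> V" "c \<noteq> a" "c \<noteq> b" "c \<noteq> q" for c
    using that a b qr \<open>q \<noteq> b\<close> not_edge_if_separated[of q V b a c]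
      ccw_rotate[of q a c, OF next_ccw(2)] ccw_rotate2[of a b c, OF next_ccw(1)]
    by (simp add: segment_in_diagonals_iff)
  have diagonal_b: "closed_segment b c \<in> diagonals C"
    if "c \<in> V" "c \<noteq> a" "c \<noteq> b" "c \<noteq> r" for c
    using that a b qr \<open>r \<noteq> a\<close> not_edge_if_separated[of a V r b c]
      ccw_rotate[of a b c, OF next_ccw(1)] ccw_rotate2[of b r c, OF next_ccw(3)]
    by (simp add: segment_in_diagonals_iff)
  \<comment> \<open>Since br and aq are sides, ar and bq are the only diagonals that can spoil the
    apexes \<open>r\<close> and \<open>q\<close>.\<close>
  let ?S' = "{closed_segment a r, closed_segment b q}"
  have not_S: "closed_segment a c \<notin> S" "closed_segment b c \<notin> S" for c
    using uv(3) a b by (auto simp: doubleton_eq_iff)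
  have sub: "?S' \<subseteq> diagonals C - S"
    using diagonal_a[of r] diagonal_b[of q] not_S qr \<open>q \<noteq> b\<close> \<open>r \<noteq> a\<close> \<open>q \<noteq> r\<close> by auto
  have card: "card ?S' = 2"
    using b \<open>r \<noteq> a\<close> \<open>q \<noteq> b\<close> qr by (auto simp: doubleton_eq_iff card_insert_if)
  have "legal_turn 2 (diagonals C - S) ?S'"
    using sub card card_mono[OF _ sub] finite_diagonals by (simp add: legal_turn_def)
  moreover have "breaker_invariant (Suc 0) S ?S'"
  proof -
    let ?K = "V - {a, b, q, r}"
    have "card ?K = card V - card {a, b, q, r}"
      using a b qr by (intro card_Diff_subset) auto
    also have "card {a, b, q, r} = 4"
      using b qr \<open>q \<noteq> b\<close> \<open>r \<noteq> a\<close> \<open>q \<noteq> r\<close> by auto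
    finally have "card ?K + Suc 0 \<le> card V - 3" using card_V by simp
    moreover have "{closed_segment a c, closed_segment b c} \<subseteq> diagonals C - (S \<union> ?S')"
      if "c \<in> ?K" for c
      using diagonal_a[of c] diagonal_b[of c] not_S b that by (auto simp: doubleton_eq_iff)
    then have "spoiling a b ?K S ?S'" using sub ab unfolding spoiling_def by auto
    ultimately show ?thesis unfolding breaker_invariant_def by blast
  qed
  ultimately show ?thesis by blast
qed

text \<open>A diagonal at \<open>a\<close> or \<open>b\<close> belongs to only one triangle over ab,
  so Maker's turn damages at most one apex of \<open>K\<close>, and only one of its two diagonals.
  Breaker takes the other.\<close>

lemma breaker_later_turn:
  assumes inv: "breaker_invariant t M B" and later: "\<not> (t = 0 \<and> M = {} \<and> B = {})"
    and "t < card V - 3"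
    and S: "legal_turn 1 (diagonals C - (M \<union> B)) S"
  shows "\<exists>S'. legal_turn 2 (diagonals C - (M \<union> B) - S) S' \<and>
    breaker_invariant (Suc t) (M \<union> S) (B \<union> S')"
proof -
  let ?U = "diagonals C - (M \<union> B) - S"
  from inv later obtain a b K where spoiling: "spoiling a b K M B" and card_K: "card K + t \<le> card V - 3"
    unfolding breaker_invariant_def by auto
  have B: "B \<subseteq> diagonals C" and ab: "succ_in V a b" and K: "K \<subseteq> V - {a, b}"
    and hit: "\<And>c. c \<in> V - {a, b} - K \<Longrightarrow> closed_segment a c \<in> B \<or> closed_segment b c \<in> B"
    and free: "\<And>c. c \<in> K \<Longrightarrow> closed_segment a c \<in> diagonals C - (M \<union> B)"
      "\<And>c. c \<in> K \<Longrightarrow> closed_segment b c \<in> diagonals C - (M \<union> B)"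
    using spoiling unfolding spoiling_def by auto
  have "a \<noteq> b" using ab by (auto simp: succ_in_def)
  have finite_K: "finite K" using K finite_vertices finite_subset by blast
  have finite_U: "finite ?U" using finite_diagonals by blast
  have S_eq: "d = e" if "d \<in> S" "e \<in> S" for d e
    using legal_turn_1_unique[OF S _ that] finite_diagonals by simp
  have invI: "breaker_invariant (Suc t) (M \<union> S) (B \<union> S')"
    if S': "S' \<subseteq> ?U" and K': "K' \<subseteq> K" "card K' + Suc t \<le> card V - 3"
      and K_hit: "\<And>c. c \<in> K - K' \<Longrightarrow> closed_segment a c \<in> S' \<or> closed_segment b c \<in> S'"
      and K_free: "\<And>c. c \<in> K' \<Longrightarrow> closed_segment a c \<notin> S \<union> S' \<and> closed_segment b c \<notin> S \<union> S'"
    for S' K'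
  proof -
    have "closed_segment a c \<in> B \<union> S' \<or> closed_segment b c \<in> B \<union> S'" if "c \<in> V - {a, b} - K'" for c
      using hit[of c] K_hit[of c] that by blast
    moreover have "{closed_segment a c, closed_segment b c} \<subseteq> diagonals C - (M \<union> S \<union> (B \<union> S'))"
      if "c \<in> K'" for c
      using K'(1) free[of c] K_free[of c] that by auto
    ultimately have "spoiling a b K' (M \<union> S) (B \<union> S')"
      using B S' ab K K'(1) unfolding spoiling_def by auto
    then show ?thesis using K'(2) unfolding breaker_invariant_def by blast
  qed
  show ?thesis
  proof (cases "K = {}")
    case True
    obtain S' where "legal_turn 2 ?U S'" using legal_turn_exists[OF finite_U] by blast
    moreover from this have "breaker_invariant (Suc t) (M \<union> S) (B \<union> S')"
      using True \<open>t < card V - 3\<close> by (intro invI[of S' "{}"]) (auto simp: legal_turn_def)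
    ultimately show ?thesis by blast
  next
    case False
    define touched where "touched c \<longleftrightarrow> closed_segment a c \<in> S \<or> closed_segment b c \<in> S" for c
    have touched_unique: "c = c'" if "touched c" "touched c'" "c \<in> K" "c' \<in> K" for c c'
    proof -
      have "{a, c} = {a, c'} \<or> {a, c} = {b, c'} \<or> {b, c} = {a, c'} \<or> {b, c} = {b, c'}"
        using that(1,2) S_eq closed_segment_eq unfolding touched_def by metis
      then show ?thesis using that(3,4) K \<open>a \<noteq> b\<close> by (auto simp: doubleton_eq_iff)
    qed
    \<comment> \<open>The apex touched by Maker, or any apex if she touched none.\<close>
    obtain c where c: "c \<in> K" and touched: "\<And>c'. c' \<in> K \<Longrightarrow> c' \<noteq> c \<Longrightarrow> \<not> touched c'"
      using False touched_unique by (metis equals0I)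
    obtain d where d: "d \<in> {closed_segment a c, closed_segment b c}" "d \<notin> S"
    proof (cases "closed_segment a c \<in> S")
      case True
      then have "closed_segment b c \<notin> S"
        using S_eq[of "closed_segment a c" "closed_segment b c"] \<open>a \<noteq> b\<close>
        by (auto simp: doubleton_eq_iff)
      then show thesis using that by blast
    qed (use that in blast)
    then have "{d} \<subseteq> ?U" using free c by blast
    then obtain S' where S': "legal_turn 2 ?U S'" "d \<in> S'"
      using legal_turn_exists_superset[OF finite_U, of "{d}" 2] by auto
    \<comment> \<open>Breaker's second claim is arbitrary and may spoil another apex, which then has
      to leave \<open>K\<close> too.\<close>
    let ?K = "{c' \<in> K - {c}. closed_segment a c' \<notin> S' \<and> closed_segment b c' \<notin> S'}"
    have "card ?K \<le> card (K - {c})" using finite_K by (intro card_mono) auto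
    moreover have "card (K - {c}) < card K" using c finite_K by (intro card_Diff1_less)
    ultimately have "breaker_invariant (Suc t) (M \<union> S) (B \<union> S')"
      using S' d(1) card_K touched
      by (intro invI[of S' ?K]) (auto simp: legal_turn_def touched_def)
    then show ?thesis using S' by blast
  qed
qed

lemma breaker_wins_bias_2:
  assumes card_V: "card V \<ge> 5"
  shows "breaker_wins_within 1 2 (diagonals C) (triangulations C) (card V - 3)"
proof (rule breaker_wins_withinI[where I = breaker_invariant])
  show "finite (diagonals C)" by (rule finite_diagonals)
  show "breaker_invariant 0 {} {}" by (simp add: breaker_invariant_def)
  show "\<exists>S'. legal_turn 2 (diagonals C - (M \<union> B) - S) S' \<and>
      breaker_invariant (Suc t) (M \<union> S) (B \<union> S')"
    if "t < card V - 3" "breaker_invariant t M B" "legal_turn 1 (diagonals C - (M \<union> B)) S" for t M B S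
  proof (cases "t = 0 \<and> M = {} \<and> B = {}")
    case True
    then show ?thesis using breaker_first_turn[OF card_V, of S] that by simp
  next
    case False
    show ?thesis using breaker_later_turn[OF that(2) False that(1,3)] .
  qed
  show "\<forall>F\<in>triangulations C. F \<inter> B \<noteq> {}" if inv: "breaker_invariant (card V - 3) M B" for M B
  proof
    fix F assume F: "F \<in> triangulations C"
    from inv card_V obtain a b K where spoiling: "spoiling a b K M B" and "card K = 0"
      unfolding breaker_invariant_def by auto
    then have B: "B \<subseteq> diagonals C" and ab: "succ_in V a b" and K: "K \<subseteq> V - {a, b}"
      and hit: "\<And>c. c \<in> V - {a, b} - K \<Longrightarrow> closed_segment a c \<in> B \<or> closed_segment b c \<in> B"
      unfolding spoiling_def by auto
    have "finite K" using K finite_vertices finite_subset by blast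
    then have "K = {}" using \<open>card K = 0\<close> by simp
    have "card V \<ge> 3" using card_V by simp
    then obtain c where c: "c \<in> V" "c \<noteq> a" "c \<noteq> b" "edge V a c \<or> closed_segment a c \<in> F"
      "edge V b c \<or> closed_segment b c \<in> F"
      using triangulation_triangle[OF _ F ab] by blast
    then have "closed_segment a c \<in> B \<or> closed_segment b c \<in> B" using hit \<open>K = {}\<close> by blast
    \<comment> \<open>What Breaker claimed is a diagonal and not a side, so this edge of the
      triangle at \<open>c\<close> must come from \<open>F\<close>.\<close>
    then show "F \<inter> B \<noteq> {}" using c B segment_in_diagonals_iff by blast
  qed
qed

end

theorem theorem1p3:
  fixes n :: nat and C :: "(real^2) set"
  assumes "n \<ge> 5" and "convex_ngon n C"
  shows "maker_wins_within 1 1 (diagonals C) (triangulations C) (n - 3) \<and>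
         breaker_wins_within 1 2 (diagonals C) (triangulations C) (n - 3) \<and>
         is_threshold_bias (diagonals C) (triangulations C) 2"
proof -
  interpret polygon C using assms(2) by unfold_locales (simp add: convex_ngon_def)
  have n: "card V = n" using assms(2) by (simp add: convex_ngon_def)
  have maker: "maker_wins_within 1 1 (diagonals C) (triangulations C) (n - 3)"
    using maker_wins_unbiased n assms(1) by simp
  have breaker: "breaker_wins_within 1 2 (diagonals C) (triangulations C) (n - 3)"
    using breaker_wins_bias_2 n assms(1) by simp
  have "\<not> breaker_wins 1 c (diagonals C) (triangulations C)" if "0 < c" "c < 2" for c
  proof -
    have "c = 1" using that by simp
    then show ?thesis using maker_wins_within_imp_not_breaker_wins[OF maker] by simp
  qed
  then show ?thesis
    using maker breaker breaker_wins_within_imp_breaker_wins[OF breaker]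
    by (simp add: is_threshold_bias_def)
qed

end
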